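(* Let $F$ be a field and $f=X^n+a_1X^{n-1}+\cdots+a_n\in F[X]$ a separable irreducible polynomial such that $F(\alpha)=S_F(f)$ for any root $\alpha$ of $f$, where $S_F(f)$ is the splitting field of $f$ over $F$. Let $G=\mathrm{Aut}(S_F(f)/F)=\{g_1,\dots,g_n\}$, and let $H_1,\dots,H_k$ be as defined in the context for this group $G$. If $H_i(a_1,\dots,a_n)\ne 0$ for all $1\le i\le k$, then $f$ is normal over $F$, i.e. $\{g(\alpha):g\in G\}$ is a basis of $S_F(f)$ over $F$.
   Context: For a finite group $G=\{g_1,\dots,g_n\}$ assign an indeterminate $X_g$ to each $g\in G$. Let $\rho_1,\dots,\rho_k$ be the irreducible complex representations of $G$, of degrees $m_1,\dots,m_k$, and put $F_i=\det\bigl(\sum_{g\in G}X_g\rho_i(g)\bigr)\in\mathbb C[X_{g_1},\dots,X_{g_n}]$; the coefficients of $F_i$ lie in the ring $\mathfrak o$ of algebraic integers. For each $i$ let $E_i\in\mathfrak o[X_{g_1},\dots,X_{g_n}]$ be a symmetrization of $F_i$, i.e. a polynomial multiple of $F_i$ in $\mathfrak o[X_{g_1},\dots,X_{g_n}]$ that is symmetric in $X_{g_1},\dots,X_{g_n}$, and let $H_i\in\mathfrak o[s_1,\dots,s_n]$ be its symmetric reduction: $E_i(X_{g_1},\dots,X_{g_n})=H_i(s_1,\dots,s_n)$, where $s_j$ is the $j$-th elementary symmetric polynomial in $X_{g_1},\dots,X_{g_n}$. The value $H_i(a_1,\dots,a_n)$ is computed after mapping the coefficients of $H_i$ into an algebraic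 closure of $F$ via a ring homomorphism $\mathfrak o\to\overline F$. *)

theory Defs
  imports "Jordan_Normal_Form.Determinant" "HOL-Library.Poly_Mapping"
    "HOL-Computational_Algebra.Polynomial"
begin

type_synonym ('v,'a) mpoly = "('v \<Rightarrow>\<^sub>0 nat) \<Rightarrow>\<^sub>0 'a"

definition mvar :: "'v \<Rightarrow> ('v,'a::comm_ring_1) mpoly" where
  "mvar v = Poly_Mapping.single (Poly_Mapping.single v 1) 1"

definition mconst :: "'a::comm_ring_1 \<Rightarrow> ('v,'a) mpoly" where
  "mconst c = Poly_Mapping.single 0 c"

definition mcoeffs_in :: "('v,'a::zero) mpoly \<Rightarrow> 'a set \<Rightarrow> bool" where
  "mcoeffs_in p A \<longleftrightarrow> (\<forall>m. Poly_Mapping.lookup p m \<in> A)"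

definition mvars_in :: "('v,'a::zero) mpoly \<Rightarrow> 'v set \<Rightarrow> bool" where
  "mvars_in p V \<longleftrightarrow> (\<forall>m \<in> Poly_Mapping.keys p. Poly_Mapping.keys m \<subseteq> V)"

definition msymmetric :: "'v set \<Rightarrow> ('v,'a::zero) mpoly \<Rightarrow> bool" where
  "msymmetric V p \<longleftrightarrow> (\<forall>\<pi> m. \<pi> permutes V \<longrightarrow>
      Poly_Mapping.lookup p (Abs_poly_mapping (\<lambda>v. Poly_Mapping.lookup m (\<pi> v)))
      = Poly_Mapping.lookup p m)"

definition msubst :: "('w,'a::comm_ring_1) mpoly \<Rightarrow> ('w \<Rightarrow> ('v,'a) mpoly) \<Rightarrow> ('v,'a) mpoly" where
  "msubst p s = (\<Sum>m\<in>Poly_Mapping.keys p. mconst (Poly_Mapping.lookup p m) *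
      (\<Prod>w\<in>Poly_Mapping.keys m. s w ^ Poly_Mapping.lookup m w))"

definition meval_map :: "('a::zero \<Rightarrow> 'b::comm_ring_1) \<Rightarrow> ('w,'a) mpoly \<Rightarrow> ('w \<Rightarrow> 'b) \<Rightarrow> 'b" where
  "meval_map \<phi> p x = (\<Sum>m\<in>Poly_Mapping.keys p. \<phi> (Poly_Mapping.lookup p m) *
      (\<Prod>w\<in>Poly_Mapping.keys m. x w ^ Poly_Mapping.lookup m w))"

definition elem_sym :: "'v set \<Rightarrow> nat \<Rightarrow> ('v,'a::comm_ring_1) mpoly" where
  "elem_sym V j = (\<Sum>T\<in>{T. T \<subseteq> V \<and> card T = j}. \<Prod>g\<in>T. mvar g)"

definition is_rep :: "('g \<Rightarrow> 'g) set \<Rightarrow> nat \<Rightarrow> (('g \<Rightarrow> 'g) \<Rightarrow> complex mat) \<Rightarrow> bool" where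
  "is_rep G d \<rho> \<longleftrightarrow> (\<forall>g\<in>G. \<rho> g \<in> carrier_mat d d) \<and> \<rho> id = 1\<^sub>m d \<and>
     (\<forall>g\<in>G. \<forall>h\<in>G. \<rho> (g \<circ> h) = \<rho> g * \<rho> h)"

definition is_subspace :: "nat \<Rightarrow> complex vec set \<Rightarrow> bool" where
  "is_subspace d W \<longleftrightarrow> W \<subseteq> carrier_vec d \<and> 0\<^sub>v d \<in> W \<and>
     (\<forall>v\<in>W. \<forall>w\<in>W. v + w \<in> W) \<and> (\<forall>c. \<forall>v\<in>W. c \<cdot>\<^sub>v v \<in> W)"

definition irreducible_rep :: "('g \<Rightarrow> 'g) set \<Rightarrow> nat \<Rightarrow> (('g \<Rightarrow> 'g) \<Rightarrow> complex mat) \<Rightarrow> bool" where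
  "irreducible_rep G d \<rho> \<longleftrightarrow> is_rep G d \<rho> \<and> d > 0 \<and>
     (\<forall>W. is_subspace d W \<and> (\<forall>g\<in>G. \<forall>w\<in>W. \<rho> g *\<^sub>v w \<in> W) \<longrightarrow>
        W = {0\<^sub>v d} \<or> W = carrier_vec d)"

definition iso_rep :: "('g \<Rightarrow> 'g) set \<Rightarrow> nat \<Rightarrow> (('g \<Rightarrow> 'g) \<Rightarrow> complex mat) \<Rightarrow> nat \<Rightarrow> (('g \<Rightarrow> 'g) \<Rightarrow> complex mat) \<Rightarrow> bool" where
  "iso_rep G d \<rho> d' \<rho>' \<longleftrightarrow> d = d' \<and>
     (\<exists>P \<in> carrier_mat d d. det P \<noteq> 0 \<and> (\<forall>g\<in>G. P * \<rho> g = \<rho>' g * P))"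

definition complete_irreps :: "('g \<Rightarrow> 'g) set \<Rightarrow> nat \<Rightarrow> (nat \<Rightarrow> nat) \<Rightarrow> (nat \<Rightarrow> ('g \<Rightarrow> 'g) \<Rightarrow> complex mat) \<Rightarrow> bool" where
  "complete_irreps G k m \<rho> \<longleftrightarrow>
     (\<forall>i<k. irreducible_rep G (m i) (\<rho> i)) \<and>
     (\<forall>i<k. \<forall>j<k. i \<noteq> j \<longrightarrow> \<not> iso_rep G (m i) (\<rho> i) (m j) (\<rho> j)) \<and>
     (\<forall>d \<sigma>. irreducible_rep G d \<sigma> \<longrightarrow> (\<exists>i<k. iso_rep G d \<sigma> (m i) (\<rho> i)))"

definition group_det_factor :: "('g \<Rightarrow> 'g) set \<Rightarrow> nat \<Rightarrow> (('g \<Rightarrow> 'g) \<Rightarrow> complex mat) \<Rightarrow> ('g \<Rightarrow> 'g, complex) mpoly" where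
  "group_det_factor G d \<rho> =
     det (mat d d (\<lambda>(r,c). \<Sum>g\<in>G. mvar g * mconst (\<rho> g $$ (r,c))))"

definition is_subfield :: "'K::field set \<Rightarrow> bool" where
  "is_subfield A \<longleftrightarrow> 0 \<in> A \<and> 1 \<in> A \<and> (\<forall>x\<in>A. \<forall>y\<in>A. x + y \<in> A \<and> x * y \<in> A) \<and>
     (\<forall>x\<in>A. - x \<in> A) \<and> (\<forall>x\<in>A. x \<noteq> 0 \<longrightarrow> inverse x \<in> A)"

definition field_adjoin :: "'K::field set \<Rightarrow> 'K set \<Rightarrow> 'K set" where
  "field_adjoin Fs A = \<Inter>{L. is_subfield L \<and> Fs \<union> A \<subseteq> L}"

definition poly_over :: "'K::field set \<Rightarrow> 'K poly \<Rightarrow> bool" where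
  "poly_over Fs p \<longleftrightarrow> (\<forall>i. coeff p i \<in> Fs)"

definition irreducible_over :: "'K::field set \<Rightarrow> 'K poly \<Rightarrow> bool" where
  "irreducible_over Fs p \<longleftrightarrow> poly_over Fs p \<and> degree p > 0 \<and>
     (\<forall>q r. poly_over Fs q \<and> poly_over Fs r \<and> p = q * r \<longrightarrow> degree q = 0 \<or> degree r = 0)"

definition is_alg_closure_of :: "'K::field set \<Rightarrow> bool" where
  "is_alg_closure_of Fs \<longleftrightarrow> is_subfield Fs \<and>
     (\<forall>p::'K poly. degree p > 0 \<longrightarrow> (\<exists>x. poly p x = 0)) \<and>
     (\<forall>x::'K. \<exists>p. p \<noteq> 0 \<and> poly_over Fs p \<and> poly p x = 0)"

text \<open>splitting field of f over Fs inside the algebraic closure\<close>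
definition splitting_field :: "'K::field set \<Rightarrow> 'K poly \<Rightarrow> 'K set" where
  "splitting_field Fs f = field_adjoin Fs {x. poly f x = 0}"

text \<open>Aut(S/Fs), automorphisms represented as maps that are the identity outside S\<close>
definition field_auts :: "'K::field set \<Rightarrow> 'K set \<Rightarrow> ('K \<Rightarrow> 'K) set" where
  "field_auts Fs S = {\<sigma>. bij_betw \<sigma> S S \<and> (\<forall>x\<in>S. \<forall>y\<in>S. \<sigma> (x + y) = \<sigma> x + \<sigma> y \<and>
      \<sigma> (x * y) = \<sigma> x * \<sigma> y) \<and> (\<forall>x\<in>Fs. \<sigma> x = x) \<and> (\<forall>x. x \<notin> S \<longrightarrow> \<sigma> x = x)}"

definition alg_ints :: "complex set" where
  "alg_ints = {x. algebraic_int x}"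

end

theory Submission
  imports Defs "Jordan_Normal_Form.Char_Poly"
begin

text \<open>
  Let \<open>\<Theta> = det (X\<^bsub>g\<inverse>h\<^esub>)\<close> be the group determinant. A composition series of
  the regular representation writes \<open>\<Theta>\<close> as a product of the \<open>F\<^sub>i\<close>, so that, with
  \<open>E\<^sub>i = Q\<^sub>i F\<^sub>i\<close>, the product of \<open>\<Theta>\<close> with the corresponding \<open>Q\<^sub>i\<close> is a product of
  \<open>E\<^sub>i\<close>. The polynomials \<open>\<Theta>\<close>, \<open>Q\<^sub>i\<close>, \<open>E\<^sub>i\<close> in this identity all visibly have algebraic
  integer coefficients (for \<open>F\<^sub>i\<close> this would need an argument), so it survives the coefficient
  map \<open>\<phi>\<close> and the evaluation at \<open>X\<^sub>g = - g \<alpha>\<close>. By Vieta's formulas the sign makes the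
  elementary symmetric polynomials take the values \<open>a\<^sub>j\<close>, hence \<open>E\<^sub>i\<close> takes the nonzero
  value \<open>H\<^sub>i(a\<^sub>1, \<dots>, a\<^sub>n)\<close> and the value of \<open>\<Theta>\<close> is nonzero. The matrix with entries
  \<open>(g\<inverse>h)(\<alpha>)\<close> is then invertible, which makes the conjugates of \<open>\<alpha>\<close> a basis.
\<close>

section \<open>Algebraic integers\<close>

text \<open>An eigenvalue is a root of the characteristic polynomial, which for an integer matrix is
  monic with integer coefficients.\<close>

lemma algebraic_int_if_int_eigenvalue:
  fixes z :: complex
  assumes A: "A \<in> carrier_mat n n" and ev: "eigenvalue (map_mat of_int A) z"
  shows "algebraic_int z"
proof -
  have "poly (char_poly (map_mat of_int A)) z = 0"
    using ev eigenvalue_root_char_poly[of "map_mat of_int A" n z] A by auto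
  then have "poly (map_poly of_int (char_poly A)) z = 0"
    by (simp add: of_int_hom.char_poly_hom[OF A])
  moreover have "lead_coeff (char_poly A) = 1"
    using degree_monic_char_poly[OF A] by auto
  ultimately show ?thesis
    unfolding algebraic_int_altdef_ipoly by blast
qed

text \<open>The additive subgroup generated by the \<open>b i\<close>. The generators are kept as an
  indexed family so that the coefficients of an element can serve as a row of an integer
  matrix.\<close>

definition int_span :: "'i set \<Rightarrow> ('i \<Rightarrow> complex) \<Rightarrow> complex set" where
  "int_span I b = {\<Sum>i\<in>I. of_int (c i) * b i | c. True}"

lemma int_spanI: "u = (\<Sum>i\<in>I. of_int (c i) * b i) \<Longrightarrow> u \<in> int_span I b"
  unfolding int_span_def by blast

lemma int_span_zero: "0 \<in> int_span I b"
  unfolding int_span_def by (auto intro!: exI[of _ "\<lambda>_. 0"])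

lemma int_span_add:
  assumes "u \<in> int_span I b" "v \<in> int_span I b"
  shows "u + v \<in> int_span I b"
proof -
  obtain c d where "u = (\<Sum>i\<in>I. of_int (c i) * b i)" "v = (\<Sum>i\<in>I. of_int (d i) * b i)"
    using assms unfolding int_span_def by auto
  then have "u + v = (\<Sum>i\<in>I. of_int (c i + d i) * b i)"
    by (simp add: sum.distrib ring_distribs)
  then show ?thesis by (rule int_spanI)
qed

lemma int_span_of_int_mult:
  assumes "u \<in> int_span I b"
  shows "of_int k * u \<in> int_span I b"
proof -
  obtain c where "u = (\<Sum>i\<in>I. of_int (c i) * b i)"
    using assms unfolding int_span_def by auto
  then have "of_int k * u = (\<Sum>i\<in>I. of_int (k * c i) * b i)"
    by (simp add: sum_distrib_left mult.assoc)
  then show ?thesis by (rule int_spanI)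
qed

lemma int_span_sum:
  "(\<And>j. j \<in> J \<Longrightarrow> u j \<in> int_span I b) \<Longrightarrow> sum u J \<in> int_span I b"
  by (induction J rule: infinite_finite_induct) (auto simp: int_span_zero int_span_add)

lemma int_span_base:
  assumes "finite I" "i \<in> I"
  shows "b i \<in> int_span I b"
proof -
  have "(\<Sum>j\<in>I. of_int (if j = i then 1 else 0) * b j) = (\<Sum>j\<in>I. if j = i then b j else 0)"
    by (rule sum.cong) auto
  also have "\<dots> = b i" using assms by simp
  finally show ?thesis by (intro int_spanI[OF sym])
qed

lemma int_span_mult:
  assumes "\<And>i. i \<in> I \<Longrightarrow> z * b i \<in> int_span I b" "u \<in> int_span I b"
  shows "z * u \<in> int_span I b"
proof -
  obtain c where "u = (\<Sum>i\<in>I. of_int (c i) * b i)"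
    using assms unfolding int_span_def by auto
  then have "z * u = (\<Sum>i\<in>I. of_int (c i) * (z * b i))"
    by (simp add: sum_distrib_left mult_ac)
  then show ?thesis using assms(1) by (auto intro!: int_span_sum int_span_of_int_mult)
qed

text \<open>Multiplication by \<open>z\<close> acts on the generators through an integer matrix. The
  vector of all generators is then an eigenvector of this matrix for the eigenvalue
  \<open>z\<close>, nonzero because of its entry \<open>b i0\<close>.\<close>

lemma algebraic_int_if_int_span_stable:
  assumes fin: "finite I" and nz: "i0 \<in> I" "b i0 \<noteq> 0"
    and stable: "\<And>i. i \<in> I \<Longrightarrow> z * b i \<in> int_span I b"
  shows "algebraic_int z"
proof -
  obtain e where e: "bij_betw e {0..<card I} I"
    using ex_bij_betw_nat_finite[OF fin] by auto
  have "\<forall>i\<in>I. \<exists>c. z * b i = (\<Sum>j\<in>I. of_int (c j) * b j)"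
    using stable unfolding int_span_def by blast
  then obtain c where c: "\<And>i. i \<in> I \<Longrightarrow> z * b i = (\<Sum>j\<in>I. of_int (c i j) * b j)"
    by metis
  define N where "N = card I"
  define M where "M = mat N N (\<lambda>(r,s). c (e r) (e s))"
  define v where "v = vec N (\<lambda>r. b (e r))"
  have M: "M \<in> carrier_mat N N" by (simp add: M_def)
  have "map_mat of_int M *\<^sub>v v = z \<cdot>\<^sub>v v"
  proof (rule eq_vecI)
    fix r assume "r < dim_vec (z \<cdot>\<^sub>v v)"
    then have r: "r < N" by (simp add: v_def)
    then have "e r \<in> I" using e by (auto simp: N_def bij_betw_def)
    then have "z * b (e r) = (\<Sum>j\<in>I. of_int (c (e r) j) * b j)" by (rule c)
    also have "\<dots> = (\<Sum>s = 0..<N. of_int (c (e r) (e s)) * b (e s))"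
      unfolding N_def by (rule sum.reindex_bij_betw[OF e, symmetric])
    finally show "(map_mat of_int M *\<^sub>v v) $ r = (z \<cdot>\<^sub>v v) $ r"
      using r by (simp add: M_def v_def scalar_prod_def)
  qed (simp add: M_def v_def)
  moreover have "v \<noteq> 0\<^sub>v N"
  proof
    assume v0: "v = 0\<^sub>v N"
    obtain r where "r < N" "e r = i0"
      using e nz by (force simp: N_def bij_betw_def)
    then have "v $ r = b i0" by (simp add: v_def)
    with v0 \<open>r < N\<close> nz show False by simp
  qed
  ultimately have "eigenvalue (map_mat of_int M) z"
    unfolding eigenvalue_def eigenvector_def by (intro exI[of _ v]) (auto simp: M_def v_def)
  then show ?thesis using algebraic_int_if_int_eigenvalue[OF M] by blast
qed

lemma algebraic_int_power_reduction:
  fixes x :: complex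
  assumes "algebraic_int x"
  obtains m :: nat and c :: "nat \<Rightarrow> int" where "0 < m" "x ^ m = (\<Sum>i<m. of_int (c i) * x ^ i)"
proof -
  obtain p where p: "poly (map_poly of_int p) x = 0" "lead_coeff p = 1"
    using assms unfolding algebraic_int_altdef_ipoly by blast
  define m where "m = degree p"
  have "poly (map_poly of_int p) x = (\<Sum>i\<le>m. of_int (coeff p i) * x ^ i)"
    unfolding poly_altdef m_def by simp
  also have "\<dots> = (\<Sum>i<m. of_int (coeff p i) * x ^ i) + x ^ m"
    using p(2) by (simp add: m_def flip: lessThan_Suc_atMost)
  finally have *: "x ^ m = (\<Sum>i<m. of_int (- coeff p i) * x ^ i)"
    using p(1) by (simp add: sum_negf eq_neg_iff_add_eq_0 add.commute)
  \<comment> \<open>For \<open>m = 0\<close> the equation would read \<open>1 = 0\<close>.\<close>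
  then have "0 < m" by (cases m) auto
  from this and * show ?thesis by (rule that)
qed

text \<open>If \<open>x\<close> and \<open>y\<close> satisfy monic integer equations of degrees
  \<open>m\<close> and \<open>n\<close>, the subgroup generated by the products
  \<open>x ^ i * y ^ j\<close> with \<open>i < m\<close> and \<open>j < n\<close> is stable under
  multiplication by \<open>x\<close> and by \<open>y\<close>, hence also by their sum and product.
  It contains the nonzero generator 1.\<close>

lemma
  fixes x y :: complex
  assumes "algebraic_int x" "algebraic_int y"
  shows algebraic_int_add: "algebraic_int (x + y)"
    and algebraic_int_mult: "algebraic_int (x * y)"
proof -
  obtain m c where m: "0 < m" "x ^ m = (\<Sum>i<m. of_int (c i) * x ^ i)"
    using algebraic_int_power_reduction[OF assms(1)] by metis
  obtain n d where n: "0 < n" "y ^ n = (\<Sum>i<n. of_int (d i) * y ^ i)"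
    using algebraic_int_power_reduction[OF assms(2)] by metis
  define I where "I = {..<m} \<times> {..<n}"
  define b where "b = (\<lambda>(i,j). x ^ i * y ^ j)"
  have fin: "finite I" by (simp add: I_def)
  have base: "x ^ i * y ^ j \<in> int_span I b" if "i < m" "j < n" for i j
    using int_span_base[OF fin, of "(i,j)" b] that by (simp add: I_def b_def)
  have X: "x * b t \<in> int_span I b" if "t \<in> I" for t
  proof -
    obtain i j where t: "t = (i,j)" "i < m" "j < n" using \<open>t \<in> I\<close> by (auto simp: I_def)
    show ?thesis
    \<comment> \<open>Only at the top exponent \<open>i = m - 1\<close> does the product leave the
      list of generators; there the monic equation rewrites \<open>x ^ m\<close> through lower
      powers.\<close>
    proof (cases "Suc i < m")
      case True
      then show ?thesis using base[of "Suc i" j] t by (simp add: b_def mult_ac)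
    next
      case False
      then have "x * b t = x ^ m * y ^ j"
        using t by (metis Suc_lessI b_def case_prod_conv mult.assoc power_Suc)
      also have "\<dots> = (\<Sum>i<m. of_int (c i) * (x ^ i * y ^ j))"
        by (simp add: m(2) sum_distrib_right mult.assoc)
      finally show ?thesis using t base by (auto intro!: int_span_sum int_span_of_int_mult)
    qed
  qed
  have Y: "y * b t \<in> int_span I b" if "t \<in> I" for t
  proof -
    obtain i j where t: "t = (i,j)" "i < m" "j < n" using \<open>t \<in> I\<close> by (auto simp: I_def)
    show ?thesis
    proof (cases "Suc j < n")
      case True
      then show ?thesis using base[of i "Suc j"] t by (simp add: b_def mult_ac)
    next
      case False
      then have "Suc j = n" using t by simp
      then have "x ^ i * y ^ n = y * b t" using t by (auto simp: b_def mult_ac)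
      moreover have "x ^ i * y ^ n = (\<Sum>j<n. of_int (d j) * (x ^ i * y ^ j))"
        by (simp add: n(2) sum_distrib_left mult_ac)
      ultimately have "y * b t = (\<Sum>j<n. of_int (d j) * (x ^ i * y ^ j))" by simp
      then show ?thesis using t base by (auto intro!: int_span_sum int_span_of_int_mult)
    qed
  qed
  have one: "(0,0) \<in> I" "b (0,0) \<noteq> 0" using m n by (auto simp: I_def b_def)
  show "algebraic_int (x + y)"
    by (rule algebraic_int_if_int_span_stable[where b = b, OF fin one]) 
      (simp add: distrib_right int_span_add X Y)
  show "algebraic_int (x * y)"
    by (rule algebraic_int_if_int_span_stable[where b = b, OF fin one])
      (simp add: mult.assoc int_span_mult[where z = x] X Y)
qed

section \<open>Evaluation of multivariate polynomials\<close>

text \<open>The monomial factor inside \<open>meval_map\<close>, isolated because it is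
  multiplicative independently of the coefficient map.\<close>

definition monomial_value :: "('v \<Rightarrow> 'b::comm_ring_1) \<Rightarrow> ('v \<Rightarrow>\<^sub>0 nat) \<Rightarrow> 'b" where
  "monomial_value x m = (\<Prod>w\<in>Poly_Mapping.keys m. x w ^ Poly_Mapping.lookup m w)"

lemma monomial_value_superset:
  assumes "finite W" "Poly_Mapping.keys m \<subseteq> W"
  shows "monomial_value x m = (\<Prod>w\<in>W. x w ^ Poly_Mapping.lookup m w)"
  unfolding monomial_value_def
  by (rule prod.mono_neutral_left) (use assms in \<open>auto simp: in_keys_iff\<close>)

lemma monomial_value_zero [simp]: "monomial_value x 0 = 1"
  by (simp add: monomial_value_def)

lemma monomial_value_add: "monomial_value x (m + m') = monomial_value x m * monomial_value x m'"
proof -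
  let ?W = "Poly_Mapping.keys m \<union> Poly_Mapping.keys m'"
  have "Poly_Mapping.keys (m + m') \<subseteq> ?W" by (rule Poly_Mapping.keys_add)
  then have "monomial_value x (m + m') = (\<Prod>w\<in>?W. x w ^ Poly_Mapping.lookup (m + m') w)"
    by (intro monomial_value_superset) auto
  also have "\<dots> = monomial_value x m * monomial_value x m'"
    by (simp add: monomial_value_superset[of ?W] lookup_add power_add prod.distrib)
  finally show ?thesis .
qed

lemma monomial_value_single [simp]: "monomial_value x (Poly_Mapping.single w (Suc 0)) = x w"
  by (simp add: monomial_value_def)

lemma mpoly_eq_sum_single:
  "p = (\<Sum>m\<in>Poly_Mapping.keys p. Poly_Mapping.single m (Poly_Mapping.lookup p m))"
  by (rule poly_mapping_eqI) (simp add: lookup_sum lookup_single when_def in_keys_iff)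

text \<open>The convolution product as a finite double sum of monomials, a form in which
  coefficients and evaluations can be treated term by term.\<close>

lemma mpoly_mult_eq_sum_single:
  fixes p q :: "('v,'a::comm_ring_1) mpoly"
  shows "p * q = (\<Sum>m\<in>Poly_Mapping.keys p. \<Sum>m'\<in>Poly_Mapping.keys q.
    Poly_Mapping.single (m + m') (Poly_Mapping.lookup p m * Poly_Mapping.lookup q m'))"
  by (subst (1) mpoly_eq_sum_single[of p], subst (1) mpoly_eq_sum_single[of q])
    (simp add: sum_product mult_single)

lemma mconst_hom: "comm_ring_hom (mconst :: 'a::comm_ring_1 \<Rightarrow> ('v,'a) mpoly)"
  by unfold_locales (simp_all add: mconst_def single_add mult_single)

text \<open>A ring homomorphism defined on a subring only, modelled by a total function
  \<open>\<phi>\<close> whose values outside \<open>R\<close> are arbitrary. The evaluation laws for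
  sums and products therefore carry the condition that coefficients lie in \<open>R\<close>.\<close>

locale subring_hom =
  fixes R :: "'a::comm_ring_1 set" and \<phi> :: "'a \<Rightarrow> 'b::comm_ring_1"
  assumes one_closed: "1 \<in> R"
    and add_closed: "\<And>x y. x \<in> R \<Longrightarrow> y \<in> R \<Longrightarrow> x + y \<in> R"
    and uminus_closed: "\<And>x. x \<in> R \<Longrightarrow> - x \<in> R"
    and mult_closed: "\<And>x y. x \<in> R \<Longrightarrow> y \<in> R \<Longrightarrow> x * y \<in> R"
    and map_one: "\<phi> 1 = 1"
    and map_add: "\<And>x y. x \<in> R \<Longrightarrow> y \<in> R \<Longrightarrow> \<phi> (x + y) = \<phi> x + \<phi> y"
    and map_mult: "\<And>x y. x \<in> R \<Longrightarrow> y \<in> R \<Longrightarrow> \<phi> (x * y) = \<phi> x * \<phi> y"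
begin

lemma zero_closed: "0 \<in> R"
  using add_closed[OF one_closed uminus_closed[OF one_closed]] by simp

lemma map_zero: "\<phi> 0 = 0"
  using map_add[OF zero_closed zero_closed] by simp

abbreviation Rpoly :: "('v,'a) mpoly \<Rightarrow> bool" where
  "Rpoly p \<equiv> mcoeffs_in p R"

abbreviation eval :: "('v \<Rightarrow> 'b) \<Rightarrow> ('v,'a) mpoly \<Rightarrow> 'b" where
  "eval x p \<equiv> meval_map \<phi> p x"

lemma Rpoly_single: "c \<in> R \<Longrightarrow> Rpoly (Poly_Mapping.single m c)"
  by (simp add: mcoeffs_in_def lookup_single when_def zero_closed)

lemma Rpoly_add: "Rpoly p \<Longrightarrow> Rpoly q \<Longrightarrow> Rpoly (p + q)"
  by (simp add: mcoeffs_in_def lookup_add add_closed)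

lemma Rpoly_zero: "Rpoly 0"
  by (simp add: mcoeffs_in_def zero_closed)

lemma Rpoly_sum: "(\<And>i. i \<in> I \<Longrightarrow> Rpoly (p i)) \<Longrightarrow> Rpoly (sum p I)"
  by (induction I rule: infinite_finite_induct) (auto simp: Rpoly_zero Rpoly_add)

lemma Rpoly_uminus: "Rpoly p \<Longrightarrow> Rpoly (- p)"
  by (simp add: mcoeffs_in_def uminus_closed)

lemma Rpoly_lookup: "Rpoly p \<Longrightarrow> Poly_Mapping.lookup p m \<in> R"
  by (simp add: mcoeffs_in_def)

lemma Rpoly_mult: "Rpoly p \<Longrightarrow> Rpoly q \<Longrightarrow> Rpoly (p * q)"
  by (subst mpoly_mult_eq_sum_single) (intro Rpoly_sum Rpoly_single mult_closed Rpoly_lookup)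

lemma Rpoly_mconst: "c \<in> R \<Longrightarrow> Rpoly (mconst c)"
  by (simp add: mconst_def Rpoly_single)

lemma Rpoly_one: "Rpoly 1"
  using Rpoly_single[OF one_closed, of 0] by simp

lemma Rpoly_mvar: "Rpoly (mvar v)"
  by (simp add: mvar_def Rpoly_single one_closed)

lemma Rpoly_prod: "(\<And>i. i \<in> I \<Longrightarrow> Rpoly (p i)) \<Longrightarrow> Rpoly (prod p I)"
  by (induction I rule: infinite_finite_induct) (auto simp: Rpoly_one Rpoly_mult)

lemma Rpoly_power: "Rpoly p \<Longrightarrow> Rpoly (p ^ n)"
  by (induction n) (auto simp: Rpoly_one Rpoly_mult)

lemma Rpoly_prod_list: "(\<And>i. i \<in> set is \<Longrightarrow> Rpoly (p i)) \<Longrightarrow> Rpoly (\<Prod>i\<leftarrow>is. p i)"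
  by (induction "is") (auto simp: Rpoly_one Rpoly_mult)

text \<open>Monomials may cancel when polynomials are added, so evaluations are compared over a
  common finite set of monomials. The extra terms vanish since \<open>\<phi> 0 = 0\<close>.\<close>

lemma eval_superset:
  assumes "finite M" "Poly_Mapping.keys p \<subseteq> M"
  shows "eval x p = (\<Sum>m\<in>M. \<phi> (Poly_Mapping.lookup p m) * monomial_value x m)"
  unfolding meval_map_def monomial_value_def
  by (rule sum.mono_neutral_left) (use assms in \<open>auto simp: in_keys_iff map_zero\<close>)

lemma eval_zero: "eval x 0 = 0"
  by (simp add: meval_map_def)

lemma eval_single: "eval x (Poly_Mapping.single m c) = \<phi> c * monomial_value x m"
  by (simp add: eval_superset[of "{m}"])

lemma eval_add:
  assumes "Rpoly p" "Rpoly q"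
  shows "eval x (p + q) = eval x p + eval x q"
proof -
  let ?M = "Poly_Mapping.keys p \<union> Poly_Mapping.keys q"
  have "eval x (p + q) = (\<Sum>m\<in>?M. \<phi> (Poly_Mapping.lookup (p + q) m) * monomial_value x m)"
    by (rule eval_superset) (use Poly_Mapping.keys_add[of p q] in auto)
  also have "\<dots> = eval x p + eval x q"
    using assms
    by (simp add: eval_superset[of ?M] lookup_add map_add Rpoly_lookup ring_distribs sum.distrib)
  finally show ?thesis .
qed

lemma eval_sum: "(\<And>i. i \<in> I \<Longrightarrow> Rpoly (p i)) \<Longrightarrow> eval x (sum p I) = (\<Sum>i\<in>I. eval x (p i))"
  by (induction I rule: infinite_finite_induct) (auto simp: eval_zero eval_add Rpoly_sum)

lemma eval_mult:
  assumes "Rpoly p" "Rpoly q"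
  shows "eval x (p * q) = eval x p * eval x q"
proof -
  have "eval x (p * q) = (\<Sum>m\<in>Poly_Mapping.keys p. \<Sum>m'\<in>Poly_Mapping.keys q.
      \<phi> (Poly_Mapping.lookup p m * Poly_Mapping.lookup q m') * monomial_value x (m + m'))"
    using assms
    by (subst mpoly_mult_eq_sum_single)
      (simp add: eval_sum eval_single Rpoly_sum Rpoly_single mult_closed Rpoly_lookup)
  also have "\<dots> = eval x p * eval x q"
    using assms unfolding meval_map_def monomial_value_def[symmetric]
    by (simp add: sum_product map_mult Rpoly_lookup monomial_value_add mult_ac)
  finally show ?thesis .
qed

lemma eval_mconst: "eval x (mconst c) = \<phi> c"
  by (simp add: mconst_def eval_single)

lemma eval_one: "eval x 1 = 1"
  using eval_single[where m = 0 and c = 1] by (simp add: map_one)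

lemma eval_mvar: "eval x (mvar v) = x v"
  using eval_single[where m = "Poly_Mapping.single v 1" and c = 1] by (simp add: mvar_def map_one)

lemma eval_uminus: "Rpoly p \<Longrightarrow> eval x (- p) = - eval x p"
  using eval_add[of p "- p" x] by (simp add: Rpoly_uminus eval_zero eq_neg_iff_add_eq_0 add.commute)

lemma eval_prod: "(\<And>i. i \<in> I \<Longrightarrow> Rpoly (p i)) \<Longrightarrow> eval x (prod p I) = (\<Prod>i\<in>I. eval x (p i))"
  by (induction I rule: infinite_finite_induct) (auto simp: eval_one eval_mult Rpoly_prod)

lemma eval_power: "Rpoly p \<Longrightarrow> eval x (p ^ n) = eval x p ^ n"
  by (induction n) (auto simp: eval_one eval_mult Rpoly_power)

lemma eval_prod_list:
  "(\<And>i. i \<in> set is \<Longrightarrow> Rpoly (p i)) \<Longrightarrow> eval x (\<Prod>i\<leftarrow>is. p i) = (\<Prod>i\<leftarrow>is. eval x (p i))"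
  by (induction "is") (auto simp: eval_one eval_mult Rpoly_prod_list)

text \<open>The Leibniz formula is built from sums, products and signs, all of which keep the
  coefficients in \<open>R\<close> and commute with evaluation.\<close>

lemma
  assumes A: "A \<in> carrier_mat n n"
    and R: "\<And>i j. i < n \<Longrightarrow> j < n \<Longrightarrow> Rpoly (A $$ (i,j))"
  shows Rpoly_det: "Rpoly (det A)"
    and eval_det: "eval x (det A) = det (map_mat (eval x) A)"
proof -
  let ?S = "{p. p permutes {0..<n}}"
  let ?P = "\<lambda>p. \<Prod>i = 0..<n. A $$ (i, p i)"
  have P: "Rpoly (?P p)" if "p \<in> ?S" for p
    using that by (intro Rpoly_prod R) (auto simp: permutes_in_image[of p "{0..<n}"])
  have s: "Rpoly (signof p * ?P p)" "eval x (signof p * ?P p) = signof p * eval x (?P p)"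
    if "p \<in> ?S" for p
    using P[OF that] by (auto simp: sign_def Rpoly_uminus eval_uminus)
  show "Rpoly (det A)"
    unfolding det_def'[OF A] by (intro Rpoly_sum s)
  have "eval x (det A) = (\<Sum>p\<in>?S. signof p * eval x (?P p))"
    unfolding det_def'[OF A] by (subst eval_sum) (use s in auto)
  also have "\<dots> = (\<Sum>p\<in>?S. signof p * (\<Prod>i = 0..<n. map_mat (eval x) A $$ (i, p i)))"
  proof (rule sum.cong[OF refl])
    fix p assume p: "p \<in> ?S"
    then have "p i < n" if "i < n" for i
      using that permutes_in_image[of p "{0..<n}" i] by auto
    then have "eval x (?P p) = (\<Prod>i = 0..<n. map_mat (eval x) A $$ (i, p i))"
      using A R by (subst eval_prod) auto
    then show "signof p * eval x (?P p) = signof p * (\<Prod>i = 0..<n. map_mat (eval x) A $$ (i, p i))"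
      by simp
  qed
  also have "\<dots> = det (map_mat (eval x) A)"
    by (rule det_def'[symmetric]) (use A in simp)
  finally show "eval x (det A) = det (map_mat (eval x) A)" .
qed

lemma eval_msubst:
  assumes p: "Rpoly p" and s: "\<And>w. Rpoly (s w)"
  shows "eval x (msubst p s) = eval (\<lambda>w. eval x (s w)) p"
  using assms unfolding msubst_def
  by (simp add: eval_sum eval_mult eval_prod eval_power eval_mconst Rpoly_mult Rpoly_mconst
      Rpoly_prod Rpoly_power Rpoly_lookup) (simp add: meval_map_def)

lemma Rpoly_elem_sym: "Rpoly (elem_sym V j)"
  unfolding elem_sym_def by (intro Rpoly_sum Rpoly_prod Rpoly_mvar)

lemma eval_elem_sym: "eval x (elem_sym V j) = (\<Sum>T\<in>{T. T \<subseteq> V \<and> card T = j}. \<Prod>g\<in>T. x g)"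
  unfolding elem_sym_def by (simp add: eval_sum eval_prod eval_mvar Rpoly_prod Rpoly_mvar)

end

lemma meval_map_cong:
  assumes "mvars_in p V" "\<And>v. v \<in> V \<Longrightarrow> x v = y v"
  shows "meval_map \<phi> p x = meval_map \<phi> p y"
  unfolding meval_map_def
proof (rule sum.cong[OF refl])
  fix m assume m: "m \<in> Poly_Mapping.keys p"
  have "(\<Prod>w\<in>Poly_Mapping.keys m. x w ^ Poly_Mapping.lookup m w) =
      (\<Prod>w\<in>Poly_Mapping.keys m. y w ^ Poly_Mapping.lookup m w)"
    using m assms by (intro prod.cong) (force simp: mvars_in_def)+
  then show "\<phi> (Poly_Mapping.lookup p m) * (\<Prod>w\<in>Poly_Mapping.keys m. x w ^ Poly_Mapping.lookup m w) =
      \<phi> (Poly_Mapping.lookup p m) * (\<Prod>w\<in>Poly_Mapping.keys m. y w ^ Poly_Mapping.lookup m w)"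
    by simp
qed

section \<open>Factorization of the group determinant\<close>

lemma det_four_block_mat_one_zero_zero:
  fixes D :: "'a::comm_ring_1 mat"
  assumes D: "D \<in> carrier_mat n n"
  shows "det (four_block_mat (1\<^sub>m r) (0\<^sub>m r n) (0\<^sub>m n r) D) = det D"
proof (induction r)
  case 0
  have "four_block_mat (1\<^sub>m 0) (0\<^sub>m 0 n) (0\<^sub>m n 0) D = D"
    using D by (intro eq_matI) auto
  then show ?case by simp
next
  case (Suc r)
  let ?L = "four_block_mat (1\<^sub>m r) (0\<^sub>m r n) (0\<^sub>m n r) D"
  have L: "?L \<in> carrier_mat (r + n) (r + n)" using D by auto
  have "four_block_mat (1\<^sub>m (Suc r)) (0\<^sub>m (Suc r) n) (0\<^sub>m n (Suc r)) D =
    four_block_mat (1\<^sub>m 1) (0\<^sub>m 1 (r + n)) (0\<^sub>m (r + n) 1) ?L"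
    using D by (intro eq_matI) auto
  also have "det \<dots> = det (1\<^sub>m 1 :: 'a mat) * det ?L"
    by (rule det_four_block_mat_lower_left_zero_col[OF _ _ refl L]) auto
  finally show ?case using Suc.IH by simp
qed

text \<open>The last column is zero except for the 1 in the corner, so the last row and column can
  be removed; this is repeated until the identity block is used up.\<close>

lemma det_four_block_mat_upper_right_zero_one:
  fixes A :: "'a::comm_ring_1 mat"
  assumes A: "A \<in> carrier_mat r r"
  shows "C \<in> carrier_mat n r \<Longrightarrow> det (four_block_mat A (0\<^sub>m r n) C (1\<^sub>m n)) = det A"
proof (induction n arbitrary: C)
  case 0
  have "four_block_mat A (0\<^sub>m r 0) C (1\<^sub>m 0) = A"
    using A 0 by (intro eq_matI) auto
  then show ?case by simp
next
  case (Suc n)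
  define C' where "C' = mat n r (\<lambda>(i,j). C $$ (i,j))"
  \<comment> \<open>The last row of the matrix without its corner entry: the last row of
    \<open>C\<close>, then the zeros of the identity block.\<close>
  define c where "c = mat 1 (r + n) (\<lambda>(i,j). if j < r then C $$ (n,j) else 0)"
  let ?L = "four_block_mat A (0\<^sub>m r n) C' (1\<^sub>m n)"
  have C': "C' \<in> carrier_mat n r" by (simp add: C'_def)
  have L: "?L \<in> carrier_mat (r + n) (r + n)" using A C' by auto
  have "four_block_mat A (0\<^sub>m r (Suc n)) C (1\<^sub>m (Suc n)) =
    four_block_mat ?L (0\<^sub>m (r + n) 1) c (1\<^sub>m 1)"
  proof (rule eq_matI, goal_cases)
    case (1 i j)
    then have "i < r \<or> r \<le> i \<and> i < r + n \<or> i = r + n" "j < r \<or> r \<le> j \<and> j < r + n \<or> j = r + n"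
      using A by (auto simp: c_def C'_def)
    then show ?case using A Suc.prems by (auto simp: C'_def c_def)
  qed (use A Suc.prems C' in auto)
  also have "det \<dots> = det ?L * det (1\<^sub>m 1 :: 'a mat)"
    by (rule det_four_block_mat_upper_right_zero_col[OF L refl]) (auto simp: c_def)
  finally show ?case using Suc.IH[OF C'] by simp
qed

text \<open>The library version requires an integral domain, an instance that
  multivariate polynomials over an unordered variable type do not have.\<close>

lemma det_four_block_mat_lower_left_zero_comm_ring:
  fixes A :: "'a::comm_ring_1 mat"
  assumes A: "A \<in> carrier_mat r r" and B: "B \<in> carrier_mat r n" and D: "D \<in> carrier_mat n n"
  shows "det (four_block_mat A B (0\<^sub>m n r) D) = det A * det D"
proof -
  let ?A = "transpose_mat A" and ?C = "transpose_mat B" and ?D = "transpose_mat D"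
  have T: "?A \<in> carrier_mat r r" "?C \<in> carrier_mat n r" "?D \<in> carrier_mat n n"
    using A B D by auto
  have "det (four_block_mat A B (0\<^sub>m n r) D) = det (transpose_mat (four_block_mat A B (0\<^sub>m n r) D))"
    by (rule det_transpose[symmetric, of _ "r + n"]) (use A D in auto)
  also have "transpose_mat (four_block_mat A B (0\<^sub>m n r) D) = four_block_mat ?A (0\<^sub>m r n) ?C ?D"
    using transpose_four_block_mat[OF A B _ D, of "0\<^sub>m n r"] by simp
  \<comment> \<open>Each diagonal block moves into a factor of its own, with an identity matrix in
    the place of the other block.\<close>
  also have "\<dots> = four_block_mat ?A (0\<^sub>m r n) ?C (1\<^sub>m n) * four_block_mat (1\<^sub>m r) (0\<^sub>m r n) (0\<^sub>m n r) ?D"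
    using T by (subst mult_four_block_mat[of _ r r _ n _ n _ _ r _ n]) auto
  also have "det \<dots> = det ?A * det ?D"
    using T by (subst det_mult[of _ "r + n"])
      (auto simp: det_four_block_mat_one_zero_zero det_four_block_mat_upper_right_zero_one)
  also have "\<dots> = det A * det D" using A D by (simp add: det_transpose)
  finally show ?thesis .
qed

section \<open>Bases adapted to a subspace\<close>

text \<open>Since the entries of \<open>v\<close> vanish from position \<open>r\<close> on, the
  product is a linear combination of the first \<open>r\<close> columns of \<open>P\<close>. Its
  partial sums stay in \<open>W\<close>.\<close>

lemma subspace_sum_cols:
  assumes W: "is_subspace d W" and P: "P \<in> carrier_mat d d" and v: "v \<in> carrier_vec d"
    and r: "r \<le> d" and cols: "\<And>j. j < r \<Longrightarrow> col P j \<in> W"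
    and zero: "\<And>i. r \<le> i \<Longrightarrow> i < d \<Longrightarrow> v $ i = 0"
  shows "P *\<^sub>v v \<in> W"
proof -
  have "vec d (\<lambda>i. \<Sum>j<s. P $$ (i,j) * v $ j) \<in> W" if "s \<le> r" for s
    using that
  proof (induction s)
    case 0
    have "vec d (\<lambda>i. \<Sum>j<0. P $$ (i,j) * v $ j) = 0\<^sub>v d" by (intro eq_vecI) auto
    then show ?case using W by (simp add: is_subspace_def)
  next
    case (Suc s)
    have "vec d (\<lambda>i. \<Sum>j<Suc s. P $$ (i,j) * v $ j) =
      vec d (\<lambda>i. \<Sum>j<s. P $$ (i,j) * v $ j) + (v $ s) \<cdot>\<^sub>v col P s"
      using Suc.prems P r by (intro eq_vecI) (auto simp: mult.commute)
    moreover have "(v $ s) \<cdot>\<^sub>v col P s \<in> W"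
      using W cols[of s] Suc.prems by (auto simp: is_subspace_def)
    ultimately show ?case using Suc W by (auto simp: is_subspace_def)
  qed
  from this[of r] have "vec d (\<lambda>i. \<Sum>j<r. P $$ (i,j) * v $ j) \<in> W" by simp
  moreover have "P *\<^sub>v v = vec d (\<lambda>i. \<Sum>j<r. P $$ (i,j) * v $ j)"
  proof (rule eq_vecI)
    fix i assume "i < dim_vec (vec d (\<lambda>i. \<Sum>j<r. P $$ (i,j) * v $ j))"
    then have i: "i < d" by simp
    have "(P *\<^sub>v v) $ i = (\<Sum>j = 0..<d. P $$ (i,j) * v $ j)"
      using P v i by (simp add: scalar_prod_def)
    also have "\<dots> = (\<Sum>j<r. P $$ (i,j) * v $ j)"
      by (rule sum.mono_neutral_right) (use r zero in auto)
    finally show "(P *\<^sub>v v) $ i = vec d (\<lambda>i. \<Sum>j<r. P $$ (i,j) * v $ j) $ i" using i by simp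
  qed (use P in simp)
  ultimately show ?thesis by simp
qed

text \<open>Among all invertible matrices take one whose number \<open>r\<close> of leading columns
  in \<open>W\<close> is as large as possible. If a vector of \<open>W\<close> had a nonzero
  coordinate at a position \<open>r\<close> or later, exchanging it into the basis would give one
  more such column. The first \<open>r\<close> columns thus span \<open>W\<close>.\<close>

lemma subspace_adapted_basis:
  assumes W: "is_subspace d W"
  obtains P r where "P \<in> carrier_mat d d" "det P \<noteq> 0" "r \<le> d"
    "\<And>v. v \<in> carrier_vec d \<Longrightarrow> P *\<^sub>v v \<in> W \<longleftrightarrow> (\<forall>i. r \<le> i \<and> i < d \<longrightarrow> v $ i = 0)"
proof -
  define good where "good r \<longleftrightarrow> r \<le> d \<and>
    (\<exists>P \<in> carrier_mat d d. det P \<noteq> 0 \<and> (\<forall>j<r. col P j \<in> W))" for r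
  have "good 0" unfolding good_def by (auto intro!: bexI[of _ "1\<^sub>m d"])
  then obtain r where r: "good r" "\<And>s. good s \<Longrightarrow> s \<le> r"
    using GreatestI_nat[of good 0 d] Greatest_le_nat[of good _ d] by (auto simp: good_def)
  then obtain P where rd: "r \<le> d" and P: "P \<in> carrier_mat d d" "det P \<noteq> 0"
      and cols: "\<And>j. j < r \<Longrightarrow> col P j \<in> W"
    unfolding good_def by auto
  have "v $ i = 0" if v: "v \<in> carrier_vec d" and PW: "P *\<^sub>v v \<in> W" and i: "r \<le> i" "i < d" for v i
  proof (rule ccontr)
    \<comment> \<open>Exchange step: column i of P is replaced by Pv and moved to position r.\<close>
    assume vi: "v $ i \<noteq> 0"
    define P1 where "P1 = replace_col P (P *\<^sub>v v) i"
    have P1: "P1 \<in> carrier_mat d d" using P by (simp add: P1_def replace_col_def)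
    \<comment> \<open>By Cramer's rule, \<open>det P1\<close> equals
      \<open>v $ i * det P\<close>.\<close>
    have dP1: "det P1 \<noteq> 0"
      unfolding P1_def using cramer_lemma_mat[OF P(1) v i(2)] vi P(2) by simp
    define P2 where "P2 = (if i = r then P1 else swapcols r i P1)"
    have P2: "P2 \<in> carrier_mat d d" using P1 by (auto simp: P2_def)
    have "det P2 \<noteq> 0"
      using dP1 det_swapcols[of r d i P1] P1 i by (auto simp: P2_def)
    moreover have "col P2 j \<in> W" if "j < Suc r" for j
    proof (cases "j = r")
      case True
      have "col P2 j = P *\<^sub>v v"
        using P1 P i True by (intro eq_vecI) (auto simp: P2_def P1_def replace_col_def)
      then show ?thesis using PW by simp
    next
      case False
      then have "col P2 j = col P j"
        using P1 P i that by (intro eq_vecI) (auto simp: P2_def P1_def replace_col_def)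
      then show ?thesis using cols False that by simp
    qed
    ultimately have "good (Suc r)" using P2 i unfolding good_def by auto
    then show False using r(2) by fastforce
  qed
  then have "P *\<^sub>v v \<in> W \<longleftrightarrow> (\<forall>i. r \<le> i \<and> i < d \<longrightarrow> v $ i = 0)" if "v \<in> carrier_vec d" for v
    using subspace_sum_cols[OF W P(1) that rd cols] that by blast
  then show ?thesis using that P rd by blast
qed

section \<open>Generic matrices of representations\<close>

definition generic_mat :: "('g \<Rightarrow> 'g) set \<Rightarrow> nat \<Rightarrow> (('g \<Rightarrow> 'g) \<Rightarrow> complex mat) \<Rightarrow> ('g \<Rightarrow> 'g, complex) mpoly mat"
  where "generic_mat G d \<rho> = mat d d (\<lambda>(r,c). \<Sum>g\<in>G. mvar g * mconst (\<rho> g $$ (r,c)))"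

lemma generic_mat_carrier [simp]: "generic_mat G d \<rho> \<in> carrier_mat d d"
  by (simp add: generic_mat_def)

lemma group_det_factor_eq_det: "group_det_factor G d \<rho> = det (generic_mat G d \<rho>)"
  by (simp add: group_det_factor_def generic_mat_def)

interpretation mconst: comm_ring_hom "mconst :: 'a::comm_ring_1 \<Rightarrow> ('v,'a) mpoly"
  by (rule mconst_hom)

text \<open>Read as a matrix of constant polynomials, \<open>P\<close> also intertwines the two
  generic matrices. Taking determinants gives equality up to the common factor
  \<open>det P\<close>.\<close>

lemma group_det_factor_conjugate:
  assumes P: "P \<in> carrier_mat d d" "det P \<noteq> 0"
    and carr: "\<And>g. g \<in> G \<Longrightarrow> \<sigma> g \<in> carrier_mat d d" "\<And>g. g \<in> G \<Longrightarrow> \<tau> g \<in> carrier_mat d d"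
    and eq: "\<And>g. g \<in> G \<Longrightarrow> P * \<sigma> g = \<tau> g * P"
  shows "group_det_factor G d \<sigma> = group_det_factor G d \<tau>"
proof -
  let ?P = "map_mat mconst P :: ('a \<Rightarrow> 'a, complex) mpoly mat"
  have P': "?P \<in> carrier_mat d d" using P by simp
  have "?P * generic_mat G d \<sigma> = generic_mat G d \<tau> * ?P"
  proof (rule eq_matI)
    fix i j assume "i < dim_row (generic_mat G d \<tau> * ?P)" "j < dim_col (generic_mat G d \<tau> * ?P)"
    then have ij: "i < d" "j < d" using P by (auto simp: generic_mat_def)
    have entry: "(X * Y) $$ (i,j) = (\<Sum>k = 0..<d. X $$ (i,k) * Y $$ (k,j))"
      if "X \<in> carrier_mat d d" "Y \<in> carrier_mat d d" for X Y :: "complex mat"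
      using that ij by (simp add: scalar_prod_def)
    have "(?P * generic_mat G d \<sigma>) $$ (i,j) =
        (\<Sum>k = 0..<d. \<Sum>g\<in>G. mvar g * mconst (P $$ (i,k) * \<sigma> g $$ (k,j)))"
      using ij P by (simp add: generic_mat_def scalar_prod_def sum_distrib_left mconst.hom_mult mult_ac)
    also have "\<dots> = (\<Sum>g\<in>G. mvar g * mconst ((P * \<sigma> g) $$ (i,j)))"
      using P carr by (subst sum.swap)
        (simp add: entry mconst.hom_sum sum_distrib_left)
    also have "\<dots> = (\<Sum>g\<in>G. mvar g * mconst ((\<tau> g * P) $$ (i,j)))"
      by (intro sum.cong) (auto simp: eq)
    also have "\<dots> = (\<Sum>k = 0..<d. \<Sum>g\<in>G. mvar g * mconst (\<tau> g $$ (i,k) * P $$ (k,j)))"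
      using P carr by (subst sum.swap)
        (simp add: entry mconst.hom_sum sum_distrib_left)
    also have "\<dots> = (generic_mat G d \<tau> * ?P) $$ (i,j)"
      using ij P by (simp add: generic_mat_def scalar_prod_def sum_distrib_right mconst.hom_mult mult.assoc)
    finally show "(?P * generic_mat G d \<sigma>) $$ (i,j) = (generic_mat G d \<tau> * ?P) $$ (i,j)" .
  qed (use P in \<open>auto simp: generic_mat_def\<close>)
  from arg_cong[OF this, of det]
  have "mconst (det P) * group_det_factor G d \<sigma> = mconst (det P) * group_det_factor G d \<tau>"
    using det_mult[OF P' generic_mat_carrier] det_mult[OF generic_mat_carrier P']
    by (simp add: group_det_factor_eq_det mult.commute)
  \<comment> \<open>The factor \<open>det P\<close> is a nonzero constant, hence a unit, and is
    cancelled by multiplying with its inverse.\<close>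
  then have "mconst (inverse (det P) * det P) * group_det_factor G d \<sigma> =
      mconst (inverse (det P) * det P) * group_det_factor G d \<tau>"
    by (simp only: mconst.hom_mult mult.assoc)
  then show ?thesis using P(2) by simp
qed

lemma group_det_factor_block_triangular:
  assumes r: "r \<le> d"
    and zero: "\<And>g i j. g \<in> G \<Longrightarrow> r \<le> i \<Longrightarrow> i < d \<Longrightarrow> j < r \<Longrightarrow> \<tau> g $$ (i,j) = 0"
  shows "group_det_factor G d \<tau> =
    group_det_factor G r (\<lambda>g. mat r r (\<lambda>(i,j). \<tau> g $$ (i,j))) *
    group_det_factor G (d - r) (\<lambda>g. mat (d - r) (d - r) (\<lambda>(i,j). \<tau> g $$ (i + r, j + r)))"
    (is "_ = group_det_factor G r ?A * group_det_factor G (d - r) ?D")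
proof -
  let ?B = "mat r (d - r) (\<lambda>(i,j). \<Sum>g\<in>G. mvar g * mconst (\<tau> g $$ (i, j + r)))"
  have "generic_mat G d \<tau> =
    four_block_mat (generic_mat G r ?A) ?B (0\<^sub>m (d - r) r) (generic_mat G (d - r) ?D)"
    using r by (intro eq_matI) (auto simp: generic_mat_def zero intro!: sum.cong sum.neutral)
  then show ?thesis
    unfolding group_det_factor_eq_det
    by (simp add: det_four_block_mat_lower_left_zero_comm_ring)
qed

text \<open>The diagonal blocks describe the action on the invariant subspace spanned by the first
  \<open>r\<close> basis vectors and on the quotient by it. In the matrix product, the inner sum
  splits at \<open>r\<close>, and for either diagonal block one of the two parts vanishes by
  \<open>zero\<close>.\<close>

lemma is_rep_block_triangular:
  assumes rep: "is_rep G d \<tau>" and r: "r \<le> d"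
    and zero: "\<And>g i j. g \<in> G \<Longrightarrow> r \<le> i \<Longrightarrow> i < d \<Longrightarrow> j < r \<Longrightarrow> \<tau> g $$ (i,j) = 0"
  shows "is_rep G r (\<lambda>g. mat r r (\<lambda>(i,j). \<tau> g $$ (i,j)))"
    and "is_rep G (d - r) (\<lambda>g. mat (d - r) (d - r) (\<lambda>(i,j). \<tau> g $$ (i + r, j + r)))"
proof -
  have id: "\<tau> id = 1\<^sub>m d" using rep by (simp add: is_rep_def)
  have entry: "\<tau> (g \<circ> h) $$ (i,j) =
      (\<Sum>k = 0..<r. \<tau> g $$ (i,k) * \<tau> h $$ (k,j)) + (\<Sum>k = r..<d. \<tau> g $$ (i,k) * \<tau> h $$ (k,j))"
    if "g \<in> G" "h \<in> G" "i < d" "j < d" for g h i j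
  proof -
    have "\<tau> g \<in> carrier_mat d d" "\<tau> h \<in> carrier_mat d d" "\<tau> (g \<circ> h) = \<tau> g * \<tau> h"
      using rep that by (auto simp: is_rep_def)
    then have "\<tau> (g \<circ> h) $$ (i,j) = (\<Sum>k = 0..<d. \<tau> g $$ (i,k) * \<tau> h $$ (k,j))"
      using that by (simp add: scalar_prod_def)
    then show ?thesis using r by (simp add: sum.atLeastLessThan_concat)
  qed
  show "is_rep G r (\<lambda>g. mat r r (\<lambda>(i,j). \<tau> g $$ (i,j)))"
    unfolding is_rep_def
  proof (intro conjI ballI)
    fix g h assume gh: "g \<in> G" "h \<in> G"
    show "mat r r (\<lambda>(i,j). \<tau> (g \<circ> h) $$ (i,j)) =
        mat r r (\<lambda>(i,j). \<tau> g $$ (i,j)) * mat r r (\<lambda>(i,j). \<tau> h $$ (i,j))"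
    proof (intro eq_matI, goal_cases)
      case (1 i j)
      moreover have "(\<Sum>k = r..<d. \<tau> g $$ (i,k) * \<tau> h $$ (k,j)) = 0"
        using 1 gh zero by (intro sum.neutral) auto
      ultimately show ?case
        using entry[OF gh, of i j] r by (simp add: scalar_prod_def)
    qed auto
  qed (use id r in \<open>auto intro!: eq_matI\<close>)
  show "is_rep G (d - r) (\<lambda>g. mat (d - r) (d - r) (\<lambda>(i,j). \<tau> g $$ (i + r, j + r)))"
    unfolding is_rep_def
  proof (intro conjI ballI)
    fix g h assume gh: "g \<in> G" "h \<in> G"
    show "mat (d - r) (d - r) (\<lambda>(i,j). \<tau> (g \<circ> h) $$ (i + r, j + r)) =
        mat (d - r) (d - r) (\<lambda>(i,j). \<tau> g $$ (i + r, j + r)) *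
        mat (d - r) (d - r) (\<lambda>(i,j). \<tau> h $$ (i + r, j + r))"
    proof (intro eq_matI, goal_cases)
      case (1 i j)
      moreover have "(\<Sum>k = 0..<r. \<tau> g $$ (i + r,k) * \<tau> h $$ (k,j + r)) = 0"
        using 1 gh zero by (intro sum.neutral) auto
      moreover have "(\<Sum>k = r..<d. \<tau> g $$ (i + r,k) * \<tau> h $$ (k,j + r)) =
          (\<Sum>k = 0..<d - r. \<tau> g $$ (i + r,k + r) * \<tau> h $$ (k + r,j + r))"
        using sum.shift_bounds_nat_ivl[of _ 0 r "d - r"] r by simp
      ultimately show ?case
        using entry[OF gh, of "i + r" "j + r"] r by (simp add: scalar_prod_def)
    qed auto
  qed (use id r in \<open>auto intro!: eq_matI\<close>)
qed

lemma is_rep_conjugate: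
  assumes rep: "is_rep G d \<sigma>" and P: "P \<in> carrier_mat d d" and Q: "Q \<in> carrier_mat d d"
    and PQ: "P * Q = 1\<^sub>m d" and QP: "Q * P = 1\<^sub>m d"
  shows "is_rep G d (\<lambda>g. Q * \<sigma> g * P)"
  unfolding is_rep_def
proof (intro conjI ballI)
  fix g h assume "g \<in> G" "h \<in> G"
  then have gh: "\<sigma> g \<in> carrier_mat d d" "\<sigma> h \<in> carrier_mat d d" "\<sigma> (g \<circ> h) = \<sigma> g * \<sigma> h"
    using rep by (auto simp: is_rep_def)
  have "Q * \<sigma> g * P * (Q * \<sigma> h * P) = Q * \<sigma> g * (P * Q) * \<sigma> h * P"
    using P Q gh by (simp add: assoc_mult_mat[of _ d d _ d _ d])
  also have "\<dots> = Q * \<sigma> (g \<circ> h) * P"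
    using P Q gh by (simp add: PQ assoc_mult_mat[of _ d d _ d _ d])
  finally show "Q * \<sigma> (g \<circ> h) * P = Q * \<sigma> g * P * (Q * \<sigma> h * P)" ..
qed (use rep P Q QP in \<open>auto simp: is_rep_def\<close>)

text \<open>An invariant subspace makes the representation block triangular in an adapted basis, so a
  composition series suffices here and complete reducibility is not needed.\<close>

lemma group_det_factor_eq_prod_irreps:
  assumes irreps: "complete_irreps G k m \<rho>"
  shows "is_rep G d \<sigma> \<Longrightarrow>
    \<exists>is. set is \<subseteq> {..<k} \<and> group_det_factor G d \<sigma> = (\<Prod>i\<leftarrow>is. group_det_factor G (m i) (\<rho> i))"
proof (induction d arbitrary: \<sigma> rule: less_induct)
  case (less d)
  note rep = \<open>is_rep G d \<sigma>\<close>
  \<comment> \<open>Degree 0 is a separate case because irreducibility includes positive degree; it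
    contributes the empty product.\<close>
  consider "d = 0" | "irreducible_rep G d \<sigma>"
    | W where "is_subspace d W" "\<And>g w. g \<in> G \<Longrightarrow> w \<in> W \<Longrightarrow> \<sigma> g *\<^sub>v w \<in> W"
        "W \<noteq> {0\<^sub>v d}" "W \<noteq> carrier_vec d"
    using rep unfolding irreducible_rep_def by blast
  then show ?case
  proof cases
    case 1
    have "det (generic_mat G 0 \<sigma>) = 1" by (rule det_dim_zero) simp
    then show ?thesis
      using 1 by (intro exI[of _ "[]"]) (simp add: group_det_factor_eq_det)
  next
    case 2
    then obtain i where i: "i < k" "iso_rep G d \<sigma> (m i) (\<rho> i)" and irr: "irreducible_rep G (m i) (\<rho> i)"
      using irreps unfolding complete_irreps_def by blast
    then obtain P where P: "P \<in> carrier_mat d d" "det P \<noteq> 0" "\<And>g. g \<in> G \<Longrightarrow> P * \<sigma> g = \<rho> i g * P"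
      and d: "d = m i"
      unfolding iso_rep_def by auto
    have "group_det_factor G d \<sigma> = group_det_factor G d (\<rho> i)"
      by (rule group_det_factor_conjugate[OF P(1,2) _ _ P(3)])
        (use rep irr d in \<open>auto simp: irreducible_rep_def is_rep_def\<close>)
    then show ?thesis using i d by (intro exI[of _ "[i]"]) simp
  next
    case (3 W)
    obtain P r where P: "P \<in> carrier_mat d d" "det P \<noteq> 0" and rd: "r \<le> d" and
      PW: "\<And>v. v \<in> carrier_vec d \<Longrightarrow> P *\<^sub>v v \<in> W \<longleftrightarrow> (\<forall>i. r \<le> i \<and> i < d \<longrightarrow> v $ i = 0)"
      using subspace_adapted_basis[OF 3(1)] by metis
    obtain Q where Q: "Q \<in> carrier_mat d d" "P * Q = 1\<^sub>m d" "Q * P = 1\<^sub>m d"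
      using det_non_zero_imp_unit[OF P] unfolding Units_def ring_mat_def by auto
    have PQv: "P *\<^sub>v (Q *\<^sub>v w) = w" if "w \<in> carrier_vec d" for w
      using that P Q by (simp flip: assoc_mult_mat_vec[of P d d Q d])
    have Wc: "W \<subseteq> carrier_vec d" using 3(1) by (simp add: is_subspace_def)
    \<comment> \<open>As \<open>W\<close> is neither zero nor the whole space, \<open>r\<close> lies
      strictly between 0 and \<open>d\<close>. Both diagonal blocks then have degree below
      \<open>d\<close> and the induction hypothesis applies to them.\<close>
    have "r \<noteq> 0"
    proof
      assume "r = 0"
      have "w = 0\<^sub>v d" if w: "w \<in> W" for w
      proof -
        have wc: "w \<in> carrier_vec d" using w Wc by auto
        then have "\<forall>i<d. (Q *\<^sub>v w) $ i = 0"
          using PW[of "Q *\<^sub>v w"] w Q \<open>r = 0\<close> by (simp add: PQv)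
        then have "Q *\<^sub>v w = 0\<^sub>v d" using Q by (intro eq_vecI) auto
        then show ?thesis using PQv[OF wc] P by auto
      qed
      then show False using 3(1,3) by (auto simp: is_subspace_def)
    qed
    moreover have "r \<noteq> d"
    proof
      assume "r = d"
      then have "w \<in> W" if "w \<in> carrier_vec d" for w
        using PW[of "Q *\<^sub>v w"] that Q PQv by auto
      then show False using 3(4) Wc by auto
    qed
    ultimately have r: "0 < r" "r < d" using rd by auto
    define \<tau> where "\<tau> = (\<lambda>g. Q * \<sigma> g * P)"
    have \<tau>: "is_rep G d \<tau>"
      unfolding \<tau>_def by (rule is_rep_conjugate[OF rep P(1) Q])
    \<comment> \<open>Column \<open>j\<close> of \<open>\<tau> g\<close> holds the coordinates, in
      the basis given by \<open>P\<close>, of \<open>\<sigma> g\<close> applied to column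
      \<open>j\<close> of \<open>P\<close>. For \<open>j < r\<close> that vector stays in the
      invariant subspace \<open>W\<close>, so its coordinates from \<open>r\<close> on
      vanish.\<close>
    have zero: "\<tau> g $$ (i,j) = 0" if g: "g \<in> G" and i: "r \<le> i" "i < d" and j: "j < r" for g i j
    proof -
      have \<sigma>g: "\<sigma> g \<in> carrier_mat d d" using rep g by (auto simp: is_rep_def)
      have \<tau>g: "\<tau> g \<in> carrier_mat d d" using \<tau> g by (auto simp: is_rep_def)
      have uj: "unit_vec d j \<in> carrier_vec d" by simp
      have "P *\<^sub>v unit_vec d j \<in> W" using PW[OF uj] j by (auto simp: unit_vec_def)
      then have "\<sigma> g *\<^sub>v (P *\<^sub>v unit_vec d j) \<in> W" by (rule 3(2)[OF g])
      also have "\<sigma> g *\<^sub>v (P *\<^sub>v unit_vec d j) = P *\<^sub>v (Q *\<^sub>v (\<sigma> g *\<^sub>v (P *\<^sub>v unit_vec d j)))"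
        using P \<sigma>g by (subst PQv) auto
      also have "Q *\<^sub>v (\<sigma> g *\<^sub>v (P *\<^sub>v unit_vec d j)) = \<tau> g *\<^sub>v unit_vec d j"
        using P Q \<sigma>g by (simp add: \<tau>_def assoc_mult_mat_vec[of _ d d _ d])
      finally have "(\<tau> g *\<^sub>v unit_vec d j) $ i = 0"
        using PW[of "\<tau> g *\<^sub>v unit_vec d j"] i \<tau>g by (auto simp del: index_mult_mat_vec)
      then show ?thesis
        using i j r \<tau>g by simp
    qed
    have "group_det_factor G d \<tau> = group_det_factor G d \<sigma>"
    proof (rule group_det_factor_conjugate[OF P])
      fix g assume g: "g \<in> G"
      then show "\<sigma> g \<in> carrier_mat d d" "\<tau> g \<in> carrier_mat d d"
        using rep \<tau> by (auto simp: is_rep_def)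
      then have "P * \<tau> g = (P * Q) * \<sigma> g * P"
        unfolding \<tau>_def using P(1) Q(1) by (simp add: assoc_mult_mat[of _ d d _ d _ d])
      then show "P * \<tau> g = \<sigma> g * P"
        using \<open>\<sigma> g \<in> carrier_mat d d\<close> by (simp add: Q(2))
    qed
    with group_det_factor_block_triangular[where \<tau> = \<tau>, OF rd zero]
    have fac: "group_det_factor G d \<sigma> =
      group_det_factor G r (\<lambda>g. mat r r (\<lambda>(i,j). \<tau> g $$ (i,j))) *
      group_det_factor G (d - r) (\<lambda>g. mat (d - r) (d - r) (\<lambda>(i,j). \<tau> g $$ (i + r, j + r)))"
      by simp
    note reps = is_rep_block_triangular[OF \<tau> rd zero]
    obtain is1 where "set is1 \<subseteq> {..<k}" "group_det_factor G r (\<lambda>g. mat r r (\<lambda>(i,j). \<tau> g $$ (i,j))) =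
        (\<Prod>i\<leftarrow>is1. group_det_factor G (m i) (\<rho> i))"
      using less.IH[OF r(2) reps(1)] by blast
    moreover have "d - r < d" using r by simp
    from less.IH[OF this reps(2)] obtain is2 where "set is2 \<subseteq> {..<k}"
        "group_det_factor G (d - r) (\<lambda>g. mat (d - r) (d - r) (\<lambda>(i,j). \<tau> g $$ (i + r, j + r))) =
        (\<Prod>i\<leftarrow>is2. group_det_factor G (m i) (\<rho> i))"
      by blast
    ultimately show ?thesis
      using fac by (intro exI[of _ "is1 @ is2"]) simp
  qed
qed

text \<open>The matrix of indeterminates is the generic matrix of the regular representation: the
  equation \<open>e r \<circ> g = e c\<close> has the unique solution
  \<open>g = inv_into UNIV (e r) \<circ> e c\<close>, so each entry of the generic matrix reduces to
  a single variable.\<close>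

lemma group_det_eq_prod_irreps:
  assumes irreps: "complete_irreps G k m \<rho>"
    and e: "bij_betw e {0..<n} G"
    and id: "id \<in> G" and comp: "\<And>g h. g \<in> G \<Longrightarrow> h \<in> G \<Longrightarrow> g \<circ> h \<in> G"
    and bij: "\<And>g. g \<in> G \<Longrightarrow> bij g" and inv: "\<And>g. g \<in> G \<Longrightarrow> inv_into UNIV g \<in> G"
  shows "\<exists>is. set is \<subseteq> {..<k} \<and> det (mat n n (\<lambda>(r,c). mvar (inv_into UNIV (e r) \<circ> e c))) =
    (\<Prod>i\<leftarrow>is. group_det_factor G (m i) (\<rho> i))"
proof -
  \<comment> \<open>The regular representation by right translations: row \<open>r\<close> of the
    permutation matrix has its 1 in the column that enumerates \<open>e r \<circ> g\<close>. With
    this orientation matrix multiplication matches composition.\<close>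
  define \<sigma> :: "('a \<Rightarrow> 'a) \<Rightarrow> complex mat"
    where "\<sigma> = (\<lambda>g. mat n n (\<lambda>(r,c). if e r \<circ> g = e c then 1 else 0))"
  have fin: "finite G" using e bij_betw_finite by blast
  have eG: "e r \<in> G" if "r < n" for r using e that by (auto simp: bij_betw_def)
  have e_eq: "e r = e c \<longleftrightarrow> r = c" if "r < n" "c < n" for r c
    using e that by (auto simp: bij_betw_def inj_on_def)
  have "is_rep G n \<sigma>"
    unfolding is_rep_def
  proof (intro conjI ballI)
    show "\<sigma> id = 1\<^sub>m n" by (intro eq_matI) (auto simp: \<sigma>_def e_eq)
    fix g h assume gh: "g \<in> G" "h \<in> G"
    show "\<sigma> (g \<circ> h) = \<sigma> g * \<sigma> h"
    proof (rule eq_matI)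
      fix r c assume "r < dim_row (\<sigma> g * \<sigma> h)" "c < dim_col (\<sigma> g * \<sigma> h)"
      then have rc: "r < n" "c < n" by (auto simp: \<sigma>_def)
      obtain l where l: "l < n" "e r \<circ> g = e l"
        using comp[OF eG[OF rc(1)] gh(1)] e by (force simp: bij_betw_def)
      have "(\<sigma> g * \<sigma> h) $$ (r,c) =
          (\<Sum>j = 0..<n. (if e l = e j then 1 else 0) * (if e j \<circ> h = e c then 1 else 0))"
        using rc l by (simp add: \<sigma>_def scalar_prod_def)
      also have "\<dots> = (\<Sum>j = 0..<n. if j = l then (if e l \<circ> h = e c then 1 else 0) else 0)"
        using l by (intro sum.cong) (auto simp: e_eq)
      also have "\<dots> = \<sigma> (g \<circ> h) $$ (r,c)"
        using rc l by (simp add: \<sigma>_def flip: comp_assoc)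
      finally show "\<sigma> (g \<circ> h) $$ (r,c) = (\<sigma> g * \<sigma> h) $$ (r,c)" ..
    qed (auto simp: \<sigma>_def)
  qed (simp add: \<sigma>_def)
  moreover have "generic_mat G n \<sigma> = mat n n (\<lambda>(r,c). mvar (inv_into UNIV (e r) \<circ> e c))"
  proof (rule eq_matI)
    fix r c assume "r < dim_row (mat n n (\<lambda>(r,c). mvar (inv_into UNIV (e r) \<circ> e c)) :: ('a \<Rightarrow> 'a, complex) mpoly mat)"
      "c < dim_col (mat n n (\<lambda>(r,c). mvar (inv_into UNIV (e r) \<circ> e c)) :: ('a \<Rightarrow> 'a, complex) mpoly mat)"
    then have rc: "r < n" "c < n" by auto
    let ?u = "inv_into UNIV (e r) \<circ> e c"
    have u: "?u \<in> G" using rc by (intro comp inv eG)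
    have "e r \<circ> g = e c \<longleftrightarrow> g = ?u" for g
      using bij[OF eG[OF rc(1)]]
      by (metis bij_is_inj bij_is_surj comp_assoc id_comp inv_o_cancel surj_iff)
    then have "generic_mat G n \<sigma> $$ (r,c) = (\<Sum>g\<in>G. if g = ?u then mvar g else 0)"
      using rc by (auto simp: generic_mat_def \<sigma>_def intro!: sum.cong)
    also have "\<dots> = mvar ?u" using fin u by simp
    finally show "generic_mat G n \<sigma> $$ (r,c) = mat n n (\<lambda>(r,c). mvar (inv_into UNIV (e r) \<circ> e c)) $$ (r,c)"
      using rc by simp
  qed (simp_all add: generic_mat_def)
  ultimately show ?thesis
    using group_det_factor_eq_prod_irreps[OF irreps, of n \<sigma>] by (simp add: group_det_factor_eq_det)
qed

section \<open>Normal simple extensions\<close>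

lemma poly_mem_of_closed:
  assumes "0 \<in> B" "\<And>x y. x \<in> B \<Longrightarrow> y \<in> B \<Longrightarrow> x + y \<in> B" "\<And>x y. x \<in> B \<Longrightarrow> y \<in> B \<Longrightarrow> x * y \<in> B"
    and "y \<in> B" "\<And>i. coeff p i \<in> B"
  shows "poly p y \<in> B"
  using assms(5)
proof (induction p)
  case (pCons c p)
  have "c \<in> B" "\<And>i. coeff p i \<in> B"
    using pCons.prems[of 0] pCons.prems[of "Suc _"] by auto
  then show ?case using pCons assms(2-4) by simp
qed (use assms(1) in simp)

locale subfield =
  fixes A :: "'K::field set"
  assumes is_subfield: "is_subfield A"
begin

lemma zero_mem [simp]: "0 \<in> A" and one_mem [simp]: "1 \<in> A"
  and add_mem: "x \<in> A \<Longrightarrow> y \<in> A \<Longrightarrow> x + y \<in> A"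
  and mult_mem: "x \<in> A \<Longrightarrow> y \<in> A \<Longrightarrow> x * y \<in> A"
  and uminus_mem: "x \<in> A \<Longrightarrow> - x \<in> A"
  using is_subfield by (auto simp: is_subfield_def)

text \<open>The case \<open>x = 0\<close> rests on the convention
  \<open>inverse 0 = 0\<close>.\<close>

lemma inverse_mem: "x \<in> A \<Longrightarrow> inverse x \<in> A"
  using is_subfield by (cases "x = 0") (auto simp: is_subfield_def)

lemma diff_mem: "x \<in> A \<Longrightarrow> y \<in> A \<Longrightarrow> x - y \<in> A"
  using add_mem[of x "- y"] uminus_mem by simp

lemma divide_mem: "x \<in> A \<Longrightarrow> y \<in> A \<Longrightarrow> x / y \<in> A"
  by (simp add: divide_inverse mult_mem inverse_mem)

lemma sum_mem: "(\<And>i. i \<in> I \<Longrightarrow> h i \<in> A) \<Longrightarrow> sum h I \<in> A"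
  by (induction I rule: infinite_finite_induct) (auto simp: add_mem)

lemma prod_mem: "(\<And>i. i \<in> I \<Longrightarrow> h i \<in> A) \<Longrightarrow> prod h I \<in> A"
  by (induction I rule: infinite_finite_induct) (auto simp: mult_mem)

lemma power_mem: "x \<in> A \<Longrightarrow> x ^ i \<in> A"
  by (induction i) (auto simp: mult_mem)

lemma poly_mem: "poly_over A p \<Longrightarrow> y \<in> A \<Longrightarrow> poly p y \<in> A"
  by (rule poly_mem_of_closed) (auto simp: poly_over_def add_mem mult_mem)

lemma poly_over_zero [simp]: "poly_over A 0"
  by (simp add: poly_over_def)

lemma poly_over_add: "poly_over A p \<Longrightarrow> poly_over A q \<Longrightarrow> poly_over A (p + q)"
  by (simp add: poly_over_def add_mem)

lemma poly_over_diff: "poly_over A p \<Longrightarrow> poly_over A q \<Longrightarrow> poly_over A (p - q)"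
  by (simp add: poly_over_def diff_mem)

lemma poly_over_mult: "poly_over A p \<Longrightarrow> poly_over A q \<Longrightarrow> poly_over A (p * q)"
  by (auto simp: poly_over_def coeff_mult intro!: sum_mem mult_mem)

lemma poly_over_monom: "c \<in> A \<Longrightarrow> poly_over A (monom c i)"
  by (simp add: poly_over_def)

lemma poly_over_pCons: "poly_over A (pCons c p) \<longleftrightarrow> c \<in> A \<and> poly_over A p"
  by (auto simp: poly_over_def coeff_pCons split: nat.splits)

text \<open>Long division with the coefficients tracked: \<open>A\<close> is a set inside the
  ambient field, so quotient and remainder must be shown to have coefficients in it. Each step
  subtracts the multiple of \<open>g\<close> that cancels the leading term.\<close>

lemma poly_over_division:
  assumes g: "poly_over A g" "g \<noteq> 0" and p: "poly_over A p"
  obtains q r where "poly_over A q" "poly_over A r" "p = q * g + r" "r = 0 \<or> degree r < degree g"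
proof -
  have "\<exists>q r. poly_over A q \<and> poly_over A r \<and> p = q * g + r \<and> (r = 0 \<or> degree r < degree g)"
    using p
  \<comment> \<open>The measure is shifted by one because the zero polynomial and the nonzero
    constants all have degree 0, yet reaching zero has to count as a decrease.\<close>
  proof (induction "if p = 0 then 0 else Suc (degree p)" arbitrary: p rule: less_induct)
    case less
    show ?case
    proof (cases "p = 0 \<or> degree p < degree g")
      case True
      then show ?thesis using less.prems by (intro exI[of _ 0] exI[of _ p]) auto
    next
      case False
      define t where "t = monom (lead_coeff p / lead_coeff g) (degree p - degree g)"
      have t: "poly_over A t"
        unfolding t_def using g less.prems
        by (intro poly_over_monom divide_mem) (auto simp: poly_over_def)
      have p0: "p \<noteq> 0" "degree g \<le> degree p" using False by auto
      have lc: "lead_coeff p / lead_coeff g \<noteq> 0" using p0 g by simp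
      have deg: "degree (t * g) = degree p"
        using p0 g lc by (simp add: t_def degree_mult_eq degree_monom_eq monom_eq_0_iff)
      have "coeff (t * g) (degree p) = lead_coeff t * lead_coeff g"
        by (metis deg lead_coeff_mult)
      also have "\<dots> = lead_coeff p"
        using lc g by (simp add: t_def degree_monom_eq)
      finally have "coeff (p - t * g) (degree p) = 0" by simp
      moreover have "degree (p - t * g) \<le> degree p"
        using deg by (intro degree_diff_le) auto
      ultimately have "p - t * g = 0 \<or> degree (p - t * g) < degree p"
        by (metis le_neq_implies_less leading_coeff_0_iff)
      then have "(if p - t * g = 0 then 0 else Suc (degree (p - t * g))) <
          (if p = 0 then 0 else Suc (degree p))"
        using p0 by auto
      moreover have "poly_over A (p - t * g)"
        using less.prems t g by (intro poly_over_diff poly_over_mult)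
      ultimately obtain q r where "poly_over A q" "poly_over A r" "p - t * g = q * g + r"
          "r = 0 \<or> degree r < degree g"
        using less.hyps by blast
      then show ?thesis using t
        by (intro exI[of _ "q + t"] exI[of _ r]) (auto simp: poly_over_add algebra_simps)
    qed
  qed
  then show ?thesis using that by blast
qed

text \<open>A nonzero polynomial \<open>h\<close> of least degree over \<open>A\<close> with root
  \<open>\<alpha>\<close> divides every polynomial over \<open>A\<close> with root
  \<open>\<alpha>\<close>, in particular \<open>f\<close>. By irreducibility \<open>f\<close> is a
  constant multiple of \<open>h\<close>, so \<open>h\<close> and all its multiples vanish at
  \<open>\<beta>\<close> too.\<close>

lemma irreducible_over_conjugate_roots:
  assumes irr: "irreducible_over A f" and roots: "poly f \<alpha> = 0" "poly f \<beta> = 0"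
    and p: "poly_over A p" "poly p \<alpha> = 0"
  shows "poly p \<beta> = 0"
proof -
  have f: "poly_over A f" "f \<noteq> 0" using irr by (auto simp: irreducible_over_def)
  let ?P = "\<lambda>h. poly_over A h \<and> h \<noteq> 0 \<and> poly h \<alpha> = 0"
  obtain h where h: "?P h" and min: "\<And>h'. ?P h' \<Longrightarrow> degree h \<le> degree h'"
    using ex_has_least_nat[of ?P f degree] f roots by auto
  have dvd: "\<exists>q'. poly_over A q' \<and> q = q' * h" if q: "poly_over A q" "poly q \<alpha> = 0" for q
  proof -
    obtain q' r where r: "poly_over A q'" "poly_over A r" "q = q' * h + r" "r = 0 \<or> degree r < degree h"
      using poly_over_division[of h q] h q by blast
    then have "poly r \<alpha> = 0" using q h by simp
    then have "r = 0" using r min[of r] by (meson leD)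
    then show ?thesis using r by auto
  qed
  obtain q where q: "poly_over A q" "f = q * h" using dvd[OF f(1) roots(1)] by blast
  have "degree h \<noteq> 0"
  proof
    assume "degree h = 0"
    then obtain c where "h = [:c:]" by (rule degree_eq_zeroE)
    with h show False by auto
  qed
  moreover have "degree q = 0 \<or> degree h = 0"
    using irr[unfolded irreducible_over_def, THEN conjunct2, THEN conjunct2, rule_format, of q h] q h
    by simp
  ultimately have "degree q = 0" by simp
  then obtain c where "q = [:c:]" by (rule degree_eq_zeroE)
  moreover have "q \<noteq> 0" using f q by auto
  ultimately have "poly h \<beta> = 0" using q(2) roots(2) by auto
  then show ?thesis using dvd[OF p] by auto
qed

lemma det_mem:
  assumes M: "M \<in> carrier_mat n n" and mem: "\<And>i j. i < n \<Longrightarrow> j < n \<Longrightarrow> M $$ (i,j) \<in> A"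
  shows "det M \<in> A"
  unfolding det_def'[OF M]
proof (intro sum_mem mult_mem prod_mem)
  fix p assume "p \<in> {p. p permutes {0..<n}}"
  show "signof p \<in> A" by (simp add: sign_def uminus_mem)
next
  fix p i assume "p \<in> {p. p permutes {0..<n}}" "i \<in> {0..<n}"
  then show "M $$ (i, p i) \<in> A"
    using permutes_in_image[of p "{0..<n}" i] by (intro mem) auto
qed

text \<open>The inverse matrix is expressed by the adjugate, whose entries are signed minors and
  hence lie in \<open>A\<close>. This keeps the solution inside the subfield.\<close>

lemma linear_system_solvable:
  assumes M: "M \<in> carrier_mat n n" and mem: "\<And>i j. i < n \<Longrightarrow> j < n \<Longrightarrow> M $$ (i,j) \<in> A"
    and det: "det M \<noteq> 0" and b: "b \<in> carrier_vec n" "\<And>i. i < n \<Longrightarrow> b $ i \<in> A"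
  obtains d where "d \<in> carrier_vec n" "\<And>i. i < n \<Longrightarrow> d $ i \<in> A" "M *\<^sub>v d = b"
proof -
  define d where "d = inverse (det M) \<cdot>\<^sub>v (adj_mat M *\<^sub>v b)"
  note adj = adj_mat[OF M]
  have adj_mem: "adj_mat M $$ (i,j) \<in> A" if "i < n" "j < n" for i j
  proof -
    have "det (mat_delete M j i) \<in> A"
    proof (rule det_mem)
      show "mat_delete M j i \<in> carrier_mat (n - 1) (n - 1)" using M by (simp add: mat_delete_def)
      fix i' j' assume "i' < n - 1" "j' < n - 1"
      then show "mat_delete M j i $$ (i',j') \<in> A"
        using M by (auto simp: mat_delete_def intro!: mem)
    qed
    then show ?thesis
      using M that by (simp add: adj_mat_def cofactor_def mult_mem power_mem uminus_mem)
  qed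
  have "d $ i \<in> A" if "i < n" for i
  proof -
    have "d $ i = inverse (det M) * (\<Sum>j = 0..<n. adj_mat M $$ (i,j) * b $ j)"
      using that b adj(1) by (simp add: d_def scalar_prod_def)
    also have "\<dots> \<in> A"
      by (intro mult_mem inverse_mem det_mem[OF M mem] sum_mem) (use that adj_mem b in auto)
    finally show ?thesis .
  qed
  moreover have "d \<in> carrier_vec n" using adj b by (simp add: d_def)
  moreover have "M *\<^sub>v d = b"
  proof -
    have "M *\<^sub>v d = inverse (det M) \<cdot>\<^sub>v (M *\<^sub>v (adj_mat M *\<^sub>v b))"
      unfolding d_def using M adj(1) b by (intro mult_mat_vec) auto
    also have "M *\<^sub>v (adj_mat M *\<^sub>v b) = (det M \<cdot>\<^sub>m 1\<^sub>m n) *\<^sub>v b"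
      using assoc_mult_mat_vec[OF M adj(1) b(1)] adj(2) by simp
    also have "\<dots> = det M \<cdot>\<^sub>v b"
    proof (rule eq_vecI)
      fix i assume "i < dim_vec (det M \<cdot>\<^sub>v b)"
      then have i: "i < n" using b by simp
      then have "((det M \<cdot>\<^sub>m 1\<^sub>m n) *\<^sub>v b) $ i =
          (\<Sum>j = 0..<n. det M * (if j = i then 1 else 0) * b $ j)"
        using b by (simp add: scalar_prod_def)
      also have "\<dots> = (\<Sum>j = 0..<n. if j = i then det M * b $ j else 0)"
        by (intro sum.cong) auto
      finally show "((det M \<cdot>\<^sub>m 1\<^sub>m n) *\<^sub>v b) $ i = (det M \<cdot>\<^sub>v b) $ i" using i b by simp
    qed (use b in simp)
    finally show ?thesis using det b by (simp add: smult_smult_assoc)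
  qed
  ultimately show ?thesis using that by blast
qed

end

text \<open>For algebraic elements the polynomial values already form a field. Any subfield
  containing \<open>A\<close> and \<open>\<alpha>\<close> contains these values.\<close>

lemma (in subfield) field_adjoin_root:
  assumes alg: "\<And>x. \<exists>p. p \<noteq> 0 \<and> poly_over A p \<and> poly p x = 0"
  shows "field_adjoin A {\<alpha>} = {poly p \<alpha> | p. poly_over A p}" (is "_ = ?B")
proof
  have B_iff: "x \<in> ?B \<longleftrightarrow> (\<exists>p. poly_over A p \<and> x = poly p \<alpha>)" for x by auto
  have const: "c \<in> ?B" if "c \<in> A" for c
    unfolding B_iff using that by (intro exI[of _ "[:c:]"]) (simp add: poly_over_pCons)
  have add: "x + y \<in> ?B" if "x \<in> ?B" "y \<in> ?B" for x y
    using that unfolding B_iff by (metis poly_over_add poly_add)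
  have mult: "x * y \<in> ?B" if "x \<in> ?B" "y \<in> ?B" for x y
    using that unfolding B_iff by (metis poly_over_mult poly_mult)
  \<comment> \<open>Write an annihilating polynomial of \<open>y\<close> of least degree as
    \<open>c + X * q'\<close>. Minimality forces \<open>c\<close> to be nonzero, as otherwise
    \<open>q'\<close> would annihilate \<open>y\<close>; hence the inverse of \<open>y\<close> is
    \<open>- inverse c * poly q' y\<close>.\<close>
  have inv: "inverse y \<in> ?B" if y: "y \<in> ?B" "y \<noteq> 0" for y
  proof -
    let ?P = "\<lambda>q. q \<noteq> 0 \<and> poly_over A q \<and> poly q y = 0"
    obtain q where q: "?P q" and min: "\<And>q'. ?P q' \<Longrightarrow> degree q \<le> degree q'"
      using ex_has_least_nat[of ?P _ degree] alg[of y] by metis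
    obtain c q' where qc: "q = pCons c q'" by (cases q) auto
    have q': "c \<in> A" "poly_over A q'" using q qc by (auto simp: poly_over_pCons)
    have "c \<noteq> 0"
    proof
      assume "c = 0"
      then have "?P q'" using q qc q' y by auto
      from min[OF this] this qc show False by simp
    qed
    moreover have "c + y * poly q' y = 0" using q qc by simp
    ultimately have "inverse y = (- inverse c) * poly q' y"
      using y by (simp add: field_simps eq_neg_iff_add_eq_0)
    moreover have "poly q' y \<in> ?B"
      by (rule poly_mem_of_closed[OF const[OF zero_mem] add mult y(1)])
        (use q' const in \<open>auto simp: poly_over_def\<close>)
    moreover have "- inverse c \<in> ?B" using q' by (intro const uminus_mem inverse_mem)
    ultimately show ?thesis by (simp only: mult)
  qed
  have "is_subfield ?B"
    unfolding is_subfield_def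
    using const[OF zero_mem] const[OF one_mem] add mult inv mult[OF const[OF uminus_mem[OF one_mem]]]
    by simp
  moreover have "\<alpha> \<in> ?B"
    unfolding B_iff by (intro exI[of _ "[:0,1:]"]) (simp add: poly_over_pCons)
  ultimately show "field_adjoin A {\<alpha>} \<subseteq> ?B"
    unfolding field_adjoin_def using const by (intro Inter_lower) auto
next
  show "?B \<subseteq> field_adjoin A {\<alpha>}"
    unfolding field_adjoin_def
  proof (intro Inter_greatest subsetI)
    fix L x assume L: "L \<in> {L. is_subfield L \<and> A \<union> {\<alpha>} \<subseteq> L}" and "x \<in> ?B"
    then obtain p where p: "poly_over A p" "x = poly p \<alpha>" by auto
    interpret L: subfield L by unfold_locales (use L in auto)
    show "x \<in> L" unfolding p(2) by (rule L.poly_mem) (use p L in \<open>auto simp: poly_over_def\<close>)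
  qed
qed

section \<open>Linear factors and Vieta's formulas\<close>

lemma prod_linear_factors_if_roots:
  fixes f :: "'K::field poly"
  assumes closed: "\<And>p::'K poly. degree p > 0 \<Longrightarrow> \<exists>x. poly p x = 0"
    and monic: "lead_coeff f = 1"
  shows "\<exists>as. f = (\<Prod>a\<leftarrow>as. [:- a, 1:])"
  using monic
proof (induction "degree f" arbitrary: f)
  case 0
  then have "f = 1" by (metis degree_eq_zeroE lead_coeff_pCons(2) pCons_one)
  then show ?case by (intro exI[of _ "[]"]) simp
next
  case (Suc n)
  obtain a where "poly f a = 0" using closed[of f] Suc.hyps(2) by auto
  then obtain q where q: "f = [:- a, 1:] * q" by (auto simp: poly_eq_0_iff_dvd)
  then have "q \<noteq> 0" using Suc.prems by auto
  have "lead_coeff q = 1" using Suc.prems unfolding q lead_coeff_mult by simp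
  moreover have "n = degree q"
    using Suc.hyps(2) \<open>q \<noteq> 0\<close> unfolding q by (subst (asm) degree_mult_eq) auto
  ultimately obtain as where "q = (\<Prod>a\<leftarrow>as. [:- a, 1:])" using Suc.hyps(1) by blast
  then show ?case using q by (intro exI[of _ "a # as"]) simp
qed

text \<open>Split \<open>f\<close> into a list of linear factors. A repeated entry would be a root
  of order at least 2, so the list enumerates the set of roots without repetition.\<close>

lemma rsquarefree_eq_prod_roots:
  fixes f :: "'K::field poly"
  assumes closed: "\<And>p::'K poly. degree p > 0 \<Longrightarrow> \<exists>x. poly p x = 0"
    and monic: "lead_coeff f = 1" and sep: "rsquarefree f"
  shows "f = (\<Prod>a | poly f a = 0. [:- a, 1:])" and "card {a. poly f a = 0} = degree f"
proof -
  obtain as where as: "f = (\<Prod>a\<leftarrow>as. [:- a, 1:])"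
    using prod_linear_factors_if_roots[OF closed monic] by blast
  have roots: "{a. poly f a = 0} = set as"
    unfolding as by (induction as) auto
  have "distinct as"
  proof (rule ccontr)
    assume "\<not> distinct as"
    then obtain xs ys zs a where "as = xs @ [a] @ ys @ [a] @ zs"
      using not_distinct_decomp by blast
    then have "f = [:- a, 1:] ^ 2 * ((\<Prod>a\<leftarrow>xs. [:- a, 1:]) * (\<Prod>a\<leftarrow>ys. [:- a, 1:]) * (\<Prod>a\<leftarrow>zs. [:- a, 1:]))"
      unfolding as by (simp only: map_append prod_list.append list.map prod_list.Cons prod_list.Nil
        power2_eq_square mult_1_left mult_1_right mult_ac)
    then have "[:- a, 1:] ^ 2 dvd f" by (rule dvdI)
    moreover have "f \<noteq> 0" using monic by auto
    ultimately have "2 \<le> order a f" by (simp add: order_divides)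
    then show False using sep unfolding rsquarefree_def
      by (metis le_zero_eq numeral_2_eq_2 Suc_le_mono One_nat_def nat.distinct(1))
  qed
  then show *: "f = (\<Prod>a | poly f a = 0. [:- a, 1:])"
    unfolding roots by (subst as) (simp add: prod.distinct_set_conv_list)
  show "card {a. poly f a = 0} = degree f"
    by (subst (2) *, subst degree_prod_eq_sum_degree) auto
qed

text \<open>Vieta's formulas with the signs absorbed into \<open>x\<close>: expanding the product,
  \<open>T\<close> is the set of factors that contribute their constant term, and the others
  contribute the indeterminate.\<close>

lemma coeff_prod_linear_factors:
  fixes x :: "'g \<Rightarrow> 'a::comm_ring_1"
  assumes fin: "finite G" and j: "j \<le> card G"
  shows "coeff (\<Prod>g\<in>G. [:x g, 1:]) (card G - j) = (\<Sum>T\<in>{T. T \<subseteq> G \<and> card T = j}. \<Prod>g\<in>T. x g)"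
proof -
  have "(\<Prod>g\<in>G. [:x g, 1:]) = (\<Prod>g\<in>G. [:x g:] + monom 1 1)"
    by (intro prod.cong) (simp_all add: monom_altdef)
  also have "\<dots> = (\<Sum>T\<in>Pow G. (\<Prod>g\<in>T. [:x g:]) * (\<Prod>g\<in>G - T. monom 1 1))"
    by (rule prod_add[OF fin])
  also have "\<dots> = (\<Sum>T\<in>Pow G. monom (\<Prod>g\<in>T. x g) (card G - card T))"
  proof (rule sum.cong[OF refl])
    fix T assume T: "T \<in> Pow G"
    then have "finite T" using fin finite_subset by auto
    have "(\<Prod>g\<in>T. [:x g:]) = [:\<Prod>g\<in>T. x g:]"
      by (induction T rule: infinite_finite_induct) (auto simp: mult.commute)
    moreover have "card (G - T) = card G - card T" using T \<open>finite T\<close> by (auto intro: card_Diff_subset)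
    ultimately show "(\<Prod>g\<in>T. [:x g:]) * (\<Prod>g\<in>G - T. monom 1 1) = monom (\<Prod>g\<in>T. x g) (card G - card T)"
      by (simp add: monom_power smult_monom)
  qed
  finally have "coeff (\<Prod>g\<in>G. [:x g, 1:]) (card G - j) =
      (\<Sum>T\<in>Pow G. if card G - card T = card G - j then \<Prod>g\<in>T. x g else 0)"
    by (simp add: coeff_sum)
  also have "\<dots> = (\<Sum>T\<in>Pow G. if card T = j then \<Prod>g\<in>T. x g else 0)"
  proof (rule sum.cong[OF refl])
    fix T assume "T \<in> Pow G"
    then have "card T \<le> card G" by (intro card_mono[OF fin]) auto
    \<comment> \<open>Both cardinalities are at most \<open>card G\<close>, so the truncated
      differences determine them.\<close>
    then have "card G - card T = card G - j \<longleftrightarrow> card T = j" using j by auto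
    then show "(if card G - card T = card G - j then \<Prod>g\<in>T. x g else 0) =
        (if card T = j then \<Prod>g\<in>T. x g else 0)" by simp
  qed
  also have "\<dots> = (\<Sum>T\<in>{T \<in> Pow G. card T = j}. \<Prod>g\<in>T. x g)"
    using fin by (intro sum.inter_filter[symmetric]) simp
  finally show ?thesis by (simp add: Pow_def)
qed

text \<open>The ambient type is the algebraic closure of \<open>Fs\<close>. Since every single root
  generates \<open>S\<close>, all roots lie in \<open>S\<close> and each element of \<open>S\<close>
  is a polynomial over \<open>Fs\<close> in any chosen root.\<close>

locale normal_simple_extension =
  fixes Fs :: "'K::field set" and f :: "'K poly" and S :: "'K set"
  assumes closure: "is_alg_closure_of Fs"
    and monic: "lead_coeff f = 1" and irr: "irreducible_over Fs f" and sep: "rsquarefree f"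
    and adjoin_root: "\<And>\<alpha>. poly f \<alpha> = 0 \<Longrightarrow> field_adjoin Fs {\<alpha>} = S"
begin

sublocale Fs: subfield Fs
  using closure by unfold_locales (simp add: is_alg_closure_of_def)

abbreviation G :: "('K \<Rightarrow> 'K) set" where "G \<equiv> field_auts Fs S"

lemma f_over: "poly_over Fs f"
  using irr by (simp add: irreducible_over_def)

lemma closed: "degree (p :: 'K poly) > 0 \<Longrightarrow> \<exists>x. poly p x = 0"
  using closure by (simp add: is_alg_closure_of_def)

lemma S_eq:
  assumes "poly f \<alpha> = 0"
  shows "S = {poly p \<alpha> | p. poly_over Fs p}"
  using Fs.field_adjoin_root[of \<alpha>] adjoin_root[OF assms] closure
  by (simp add: is_alg_closure_of_def)

lemma mem_S_iff: "poly f \<alpha> = 0 \<Longrightarrow> x \<in> S \<longleftrightarrow> (\<exists>p. poly_over Fs p \<and> x = poly p \<alpha>)"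
  using S_eq by auto

lemma poly_in_S: "poly f \<alpha> = 0 \<Longrightarrow> poly_over Fs p \<Longrightarrow> poly p \<alpha> \<in> S"
  using mem_S_iff by auto

lemma root_ex: obtains \<alpha> where "poly f \<alpha> = 0"
  using closed[of f] irr by (auto simp: irreducible_over_def)

lemma S_subfield: "subfield S"
proof -
  obtain \<alpha> where "poly f \<alpha> = 0" by (rule root_ex)
  then have S: "S = \<Inter>{L. is_subfield L \<and> Fs \<union> {\<alpha>} \<subseteq> L}"
    using adjoin_root by (simp add: field_adjoin_def)
  show ?thesis
    unfolding S by unfold_locales (auto simp: is_subfield_def)
qed

sublocale S: subfield S
  by (rule S_subfield)

lemma Fs_subset_S: "x \<in> Fs \<Longrightarrow> x \<in> S"
proof -
  assume "x \<in> Fs"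
  obtain \<alpha> where "poly f \<alpha> = 0" by (rule root_ex)
  from poly_in_S[OF this, of "[:x:]"] \<open>x \<in> Fs\<close> show ?thesis by (simp add: Fs.poly_over_pCons)
qed

lemma root_in_S: "poly f \<alpha> = 0 \<Longrightarrow> \<alpha> \<in> S"
  using poly_in_S[of \<alpha> "[:0,1:]"] by (simp add: Fs.poly_over_pCons)

text \<open>Division by \<open>f\<close> does not change the value at a root, so the remainder
  represents \<open>x\<close> by powers of \<open>\<alpha>\<close> below the degree of
  \<open>f\<close>.\<close>

lemma representation:
  assumes \<alpha>: "poly f \<alpha> = 0" and x: "x \<in> S"
  obtains p where "poly_over Fs p" "x = (\<Sum>j = 0..<degree f. coeff p j * \<alpha> ^ j)"
    "x = poly p \<alpha>" "p = 0 \<or> degree p < degree f"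
proof -
  obtain q where q: "poly_over Fs q" "x = poly q \<alpha>" using mem_S_iff[OF \<alpha>] x by auto
  have "f \<noteq> 0" using monic by auto
  then obtain s p where p: "poly_over Fs p" "q = s * f + p" "p = 0 \<or> degree p < degree f"
    using Fs.poly_over_division[OF f_over _ q(1)] by blast
  have xp: "x = poly p \<alpha>" using q p \<alpha> by simp
  also have "\<dots> = (\<Sum>j\<le>degree p. coeff p j * \<alpha> ^ j)" by (rule poly_altdef)
  also have "\<dots> = (\<Sum>j = 0..<degree f. coeff p j * \<alpha> ^ j)"
  proof (cases "p = 0")
    case False
    then show ?thesis using p(3)
      by (intro sum.mono_neutral_left) (auto simp: coeff_eq_0)
  qed simp
  finally show ?thesis using that p xp by blast
qed

section \<open>Automorphisms and their action on the roots\<close>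

lemma aut_poly:
  assumes g: "g \<in> G" and p: "poly_over Fs p" and y: "y \<in> S"
  shows "g (poly p y) = poly p (g y)"
  using p
proof (induction p)
  case 0
  then show ?case using g by (simp add: field_auts_def)
next
  case (pCons c p)
  then have c: "c \<in> Fs" and p: "poly_over Fs p" by (auto simp: Fs.poly_over_pCons)
  then have "poly p y \<in> S"
    using y Fs_subset_S by (intro S.poly_mem) (auto simp: poly_over_def)
  then have "g (c + y * poly p y) = g c + g y * g (poly p y)"
    using g c y Fs_subset_S S.mult_mem by (simp add: field_auts_def)
  then show ?case using pCons.IH[OF p] g c by (simp add: field_auts_def)
qed

lemma aut_mem: "g \<in> G \<Longrightarrow> x \<in> S \<Longrightarrow> g x \<in> S"
  by (auto simp: field_auts_def bij_betw_def)

lemma aut_root: "g \<in> G \<Longrightarrow> poly f \<alpha> = 0 \<Longrightarrow> poly f (g \<alpha>) = 0"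
  using aut_poly[OF _ f_over root_in_S, of g \<alpha>] by (simp add: field_auts_def)

text \<open>Automorphisms are the identity outside \<open>S\<close>, so they are permutations of the
  whole type. This makes \<open>inv_into UNIV\<close> the inverse in the group.\<close>

lemma aut_bij:
  assumes "g \<in> G"
  shows "bij g"
proof -
  have "bij_betw g S S" "bij_betw g (- S) (- S)"
    using assms by (auto simp: field_auts_def bij_betw_def inj_on_def image_iff)
  then have "bij_betw g (S \<union> - S) (S \<union> - S)" by (rule bij_betw_combine) auto
  then show ?thesis by simp
qed

lemma id_in_G: "id \<in> G"
  by (simp add: field_auts_def)

lemma comp_in_G: "g \<in> G \<Longrightarrow> h \<in> G \<Longrightarrow> g \<circ> h \<in> G"
  using aut_mem unfolding field_auts_def by (auto intro: bij_betw_trans)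

lemma inv_in_G:
  assumes g: "g \<in> G"
  shows "inv_into UNIV g \<in> G"
proof -
  have b: "bij g" by (rule aut_bij[OF g])
  have gS: "bij_betw g S S" using g by (simp add: field_auts_def)
  have inv_eq: "inv_into UNIV g y = x \<longleftrightarrow> y = g x" for x y
    using b by (metis bij_inv_eq_iff)
  have invS: "inv_into UNIV g y \<in> S" if "y \<in> S" for y
  proof -
    have "y \<in> g ` S" using gS that by (simp add: bij_betw_def)
    then obtain x where "x \<in> S" "y = g x" by blast
    then show ?thesis using inv_eq[of y x] by simp
  qed
  have "bij_betw (inv_into UNIV g) S S"
    by (rule bij_betw_byWitness[of _ g]) (use b gS invS inv_eq in \<open>auto simp: bij_betw_def inv_eq surj_f_inv_f\<close>)
  moreover have "inv_into UNIV g (x + y) = inv_into UNIV g x + inv_into UNIV g y \<and>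
      inv_into UNIV g (x * y) = inv_into UNIV g x * inv_into UNIV g y"
    if "x \<in> S" "y \<in> S" for x y
  proof -
    have "g (inv_into UNIV g x + inv_into UNIV g y) = g (inv_into UNIV g x) + g (inv_into UNIV g y)"
      "g (inv_into UNIV g x * inv_into UNIV g y) = g (inv_into UNIV g x) * g (inv_into UNIV g y)"
      using g invS that by (auto simp: field_auts_def)
    then show ?thesis using inv_eq by (metis (no_types))
  qed
  ultimately show ?thesis
    using g by (auto simp: field_auts_def inv_eq)
qed

lemma aut_eqI:
  assumes "g \<in> G" "h \<in> G" "poly f \<alpha> = 0" "g \<alpha> = h \<alpha>"
  shows "g = h"
proof
  fix x
  show "g x = h x"
  proof (cases "x \<in> S")
    case True
    then obtain p where p: "poly_over Fs p" "x = poly p \<alpha>" using mem_S_iff assms(3) by auto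
    show ?thesis
      unfolding p(2) aut_poly[OF assms(1) p(1) root_in_S[OF assms(3)]]
        aut_poly[OF assms(2) p(1) root_in_S[OF assms(3)]] assms(4) ..
  next
    case False
    then show ?thesis using assms by (simp add: field_auts_def)
  qed
qed

text \<open>Send \<open>poly p \<alpha>\<close> to \<open>poly p \<beta>\<close>. This is well
  defined because a polynomial over \<open>Fs\<close> that vanishes at one root of \<open>f\<close>
  vanishes at the other; the same fact with the roots exchanged gives injectivity, and surjectivity
  holds because \<open>\<beta>\<close> also generates \<open>S\<close>.\<close>

lemma aut_exists:
  assumes \<alpha>: "poly f \<alpha> = 0" and \<beta>: "poly f \<beta> = 0"
  shows "\<exists>g\<in>G. g \<alpha> = \<beta>"
proof -
  define \<sigma> where "\<sigma> x = (if x \<in> S then poly (SOME p. poly_over Fs p \<and> x = poly p \<alpha>) \<beta> else x)" for x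
  have eq: "poly p \<beta> = poly q \<beta>"
    if "poly f \<alpha> = 0" "poly f \<beta> = 0" "poly_over Fs p" "poly_over Fs q" "poly p \<alpha> = poly q \<alpha>" for p q \<alpha> \<beta>
    using Fs.irreducible_over_conjugate_roots[OF irr that(1,2), of "p - q"] that
    by (simp add: Fs.poly_over_diff)
  have \<sigma>: "\<sigma> (poly p \<alpha>) = poly p \<beta>" if p: "poly_over Fs p" for p
  proof -
    let ?q = "SOME q. poly_over Fs q \<and> poly p \<alpha> = poly q \<alpha>"
    have "poly_over Fs ?q \<and> poly p \<alpha> = poly ?q \<alpha>" by (rule someI[of _ p]) (simp add: p)
    then have "poly ?q \<beta> = poly p \<beta>" using eq[OF \<alpha> \<beta>] p by metis
    then show ?thesis using poly_in_S[OF \<alpha> p] by (simp add: \<sigma>_def)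
  qed
  have "inj_on \<sigma> S"
  proof (rule inj_onI)
    fix x y assume "x \<in> S" "y \<in> S" and xy: "\<sigma> x = \<sigma> y"
    then obtain p q where pq: "poly_over Fs p" "poly_over Fs q" "x = poly p \<alpha>" "y = poly q \<alpha>"
      using mem_S_iff[OF \<alpha>] by auto
    then have "poly p \<beta> = poly q \<beta>" using xy \<sigma> by simp
    from eq[OF \<beta> \<alpha> pq(1,2) this] show "x = y" using pq by simp
  qed
  moreover have "\<sigma> ` S = S"
    using \<sigma> unfolding image_def by (subst (1) S_eq[OF \<alpha>], subst S_eq[OF \<beta>]) force
  moreover have "\<sigma> (x + y) = \<sigma> x + \<sigma> y \<and> \<sigma> (x * y) = \<sigma> x * \<sigma> y" if xy: "x \<in> S" "y \<in> S" for x y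
  proof -
    obtain p q where "poly_over Fs p" "poly_over Fs q" "x = poly p \<alpha>" "y = poly q \<alpha>"
      using mem_S_iff[OF \<alpha>] xy by auto
    then show ?thesis
      using \<sigma>[of p] \<sigma>[of q] \<sigma>[of "p + q"] \<sigma>[of "p * q"]
      by (simp add: Fs.poly_over_add Fs.poly_over_mult)
  qed
  moreover have "\<sigma> x = x" if "x \<in> Fs" for x
    using \<sigma>[of "[:x:]"] that by (simp add: Fs.poly_over_pCons)
  ultimately have "\<sigma> \<in> G" by (simp add: field_auts_def bij_betw_def \<sigma>_def)
  moreover have "\<sigma> \<alpha> = \<beta>" using \<sigma>[of "[:0,1:]"] by (simp add: Fs.poly_over_pCons)
  ultimately show ?thesis by blast
qed

lemma bij_betw_roots:
  assumes \<alpha>: "poly f \<alpha> = 0"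
  shows "bij_betw (\<lambda>g. g \<alpha>) G {x. poly f x = 0}"
  unfolding bij_betw_def
proof
  show "inj_on (\<lambda>g. g \<alpha>) G" using aut_eqI[OF _ _ \<alpha>] by (auto intro: inj_onI)
  show "(\<lambda>g. g \<alpha>) ` G = {x. poly f x = 0}"
    using aut_root \<alpha> aut_exists[OF \<alpha>] by force
qed

lemma finite_G: "finite G" and card_G: "card G = degree f"
proof -
  obtain \<alpha> where \<alpha>: "poly f \<alpha> = 0" by (rule root_ex)
  note card = rsquarefree_eq_prod_roots(2)[OF closed monic sep]
  show "card G = degree f" using bij_betw_same_card[OF bij_betw_roots[OF \<alpha>]] card by simp
  have "f \<noteq> 0" using monic by auto
  then show "finite G" using bij_betw_finite[OF bij_betw_roots[OF \<alpha>]] poly_roots_finite by blast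
qed

lemma f_eq_prod:
  assumes \<alpha>: "poly f \<alpha> = 0"
  shows "f = (\<Prod>g\<in>G. [:- g \<alpha>, 1:])"
  using rsquarefree_eq_prod_roots(1)[OF closed monic sep]
    prod.reindex_bij_betw[OF bij_betw_roots[OF \<alpha>], of "\<lambda>x. [:- x, 1:]"] by simp

text \<open>Membership in \<open>S\<close> is carried through the induction because an automorphism
  is additive and multiplicative on \<open>S\<close> only.\<close>

lemma aut_lincomb:
  assumes g: "g \<in> G" and I: "finite I" "\<And>i. i \<in> I \<Longrightarrow> c i \<in> Fs" "\<And>i. i \<in> I \<Longrightarrow> y i \<in> S"
  shows "(\<Sum>i\<in>I. c i * y i) \<in> S \<and> g (\<Sum>i\<in>I. c i * y i) = (\<Sum>i\<in>I. c i * g (y i))"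
  using I
proof (induction I rule: finite_induct)
  case empty
  then show ?case using g by (simp add: field_auts_def)
next
  case (insert i I)
  then have "c i * y i \<in> S" using Fs_subset_S by (intro S.mult_mem) auto
  moreover have "g (c i * y i) = c i * g (y i)"
    using g insert.prems Fs_subset_S by (simp add: field_auts_def)
  ultimately show ?case using insert g by (simp add: S.add_mem field_auts_def)
qed

text \<open>The entries are the values of the group matrix at \<open>X\<^sub>g = - g \<alpha>\<close>. Expressing the conjugates in
  powers of \<open>\<alpha>\<close> factors it as a Vandermonde matrix times a matrix over the base field, which
  is therefore invertible as well.\<close>

lemma normal_basis_if_group_det_nonzero:
  assumes \<alpha>: "poly f \<alpha> = 0" and e: "bij_betw e {0..<n} G" and n: "degree f = n"
    and det: "det (mat n n (\<lambda>(r,c). - (inv_into UNIV (e r) \<circ> e c) \<alpha>)) \<noteq> 0" (is "det ?M \<noteq> 0")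
  shows "\<forall>c. (\<forall>g\<in>G. c g \<in> Fs) \<and> (\<Sum>g\<in>G. c g * g \<alpha>) = 0 \<longrightarrow> (\<forall>g\<in>G. c g = 0)"
    and "\<forall>x\<in>S. \<exists>c. (\<forall>g\<in>G. c g \<in> Fs) \<and> x = (\<Sum>g\<in>G. c g * g \<alpha>)"
proof -
  have eG: "e r \<in> G" if "r < n" for r using e that by (auto simp: bij_betw_def)
  have iG: "inv_into UNIV (e r) \<in> G" if "r < n" for r using eG[OF that] by (rule inv_in_G)
  have eS: "e r \<alpha> \<in> S" if "r < n" for r using aut_mem[OF eG[OF that] root_in_S[OF \<alpha>]] .
  have reindex: "(\<Sum>g\<in>G. h g) = (\<Sum>c = 0..<n. h (e c))" for h :: "('K \<Rightarrow> 'K) \<Rightarrow> 'K"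
    by (rule sum.reindex_bij_betw[OF e, symmetric])
  show "\<forall>c. (\<forall>g\<in>G. c g \<in> Fs) \<and> (\<Sum>g\<in>G. c g * g \<alpha>) = 0 \<longrightarrow> (\<forall>g\<in>G. c g = 0)"
  proof (intro allI impI)
    fix c assume c: "(\<forall>g\<in>G. c g \<in> Fs) \<and> (\<Sum>g\<in>G. c g * g \<alpha>) = 0"
    define v where "v = vec n (\<lambda>j. c (e j))"
    \<comment> \<open>Up to sign, row \<open>r\<close> is the given linear relation with the inverse
      of \<open>e r\<close> applied to it; the coefficients lie in \<open>Fs\<close> and stay
      fixed.\<close>
    have "?M *\<^sub>v v = 0\<^sub>v n"
    proof (rule eq_vecI)
      fix r assume "r < dim_vec (0\<^sub>v n :: 'K vec)"
      then have r: "r < n" by simp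
      have "(?M *\<^sub>v v) $ r = - (\<Sum>j = 0..<n. c (e j) * inv_into UNIV (e r) (e j \<alpha>))"
        using r by (simp add: v_def scalar_prod_def sum_negf mult.commute)
      also have "(\<Sum>j = 0..<n. c (e j) * inv_into UNIV (e r) (e j \<alpha>)) =
          inv_into UNIV (e r) (\<Sum>j = 0..<n. c (e j) * e j \<alpha>)"
        using aut_lincomb[OF iG[OF r], of "{0..<n}" "\<lambda>j. c (e j)" "\<lambda>j. e j \<alpha>"] c eG eS by simp
      also have "(\<Sum>j = 0..<n. c (e j) * e j \<alpha>) = 0" using c by (simp add: reindex)
      also have "inv_into UNIV (e r) 0 = 0" using iG[OF r] by (simp add: field_auts_def)
      finally show "(?M *\<^sub>v v) $ r = 0\<^sub>v n $ r" using r by simp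
    qed simp
    then have "v = 0\<^sub>v n"
      using det det_0_iff_vec_prod_zero[of ?M n, OF mat_carrier] vec_carrier[of n "\<lambda>j. c (e j)"]
      unfolding v_def by blast
    then have "c (e j) = 0" if "j < n" for j
      using that by (metis index_vec index_zero_vec(1) v_def)
    then show "\<forall>g\<in>G. c g = 0" using e by (force simp: bij_betw_def)
  qed
  have "\<forall>c\<in>{0..<n}. \<exists>p. poly_over Fs p \<and> - e c \<alpha> = poly p \<alpha> \<and> (p = 0 \<or> degree p < n)"
  proof
    fix c assume "c \<in> {0..<n}"
    then have "- e c \<alpha> \<in> S" using eS S.uminus_mem by simp
    then show "\<exists>p. poly_over Fs p \<and> - e c \<alpha> = poly p \<alpha> \<and> (p = 0 \<or> degree p < n)"
      using representation[OF \<alpha>] n by metis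
  qed
  then obtain p where p: "\<And>c. c < n \<Longrightarrow> poly_over Fs (p c)" "\<And>c. c < n \<Longrightarrow> - e c \<alpha> = poly (p c) \<alpha>"
      "\<And>c. c < n \<Longrightarrow> p c = 0 \<or> degree (p c) < n"
    by (metis atLeastLessThan_iff zero_le)
  have p_sum: "poly (p c) y = (\<Sum>j = 0..<n. coeff (p c) j * y ^ j)" if "c < n" for c y
  proof (cases "p c = 0")
    case False
    then have "degree (p c) < n" using p(3)[OF that] by simp
    then show ?thesis
      unfolding poly_altdef by (intro sum.mono_neutral_left) (auto simp: coeff_eq_0)
  qed simp
  define C where "C = mat n n (\<lambda>(j,c). coeff (p c) j)"
  define V where "V = mat n n (\<lambda>(r,j). (inv_into UNIV (e r) \<alpha>) ^ j)"
  have C: "C \<in> carrier_mat n n" and V: "V \<in> carrier_mat n n" by (auto simp: C_def V_def)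
  \<comment> \<open>Applying the inverse of \<open>e r\<close> to
    \<open>- e c \<alpha> = poly (p c) \<alpha>\<close> keeps the coefficients and replaces
    \<open>\<alpha>\<close> by a conjugate, whose powers form row \<open>r\<close> of
    \<open>V\<close>.\<close>
  have "?M = V * C"
  proof (rule eq_matI)
    fix r c assume "r < dim_row (V * C)" "c < dim_col (V * C)"
    then have rc: "r < n" "c < n" by (auto simp: C_def V_def)
    have "inv_into UNIV (e r) (- e c \<alpha>) = inv_into UNIV (e r) (poly (p c) \<alpha>)" by (simp add: p rc)
    also have "\<dots> = poly (p c) (inv_into UNIV (e r) \<alpha>)"
      by (rule aut_poly[OF iG[OF rc(1)] p(1)[OF rc(2)] root_in_S[OF \<alpha>]])
    also have "\<dots> = (V * C) $$ (r,c)"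
      using rc by (simp add: p_sum C_def V_def scalar_prod_def mult.commute)
    finally have "inv_into UNIV (e r) (- e c \<alpha>) = (V * C) $$ (r,c)" .
    moreover have "inv_into UNIV (e r) (- e c \<alpha>) = - inv_into UNIV (e r) (e c \<alpha>)"
      using aut_lincomb[OF iG[OF rc(1)], of "{()}" "\<lambda>_. -1" "\<lambda>_. e c \<alpha>"] eS[OF rc(2)]
      by (simp add: Fs.uminus_mem)
    ultimately show "?M $$ (r,c) = (V * C) $$ (r,c)" using rc by simp
  qed (auto simp: C_def V_def)
  then have "det C \<noteq> 0" using det det_mult[OF V C] by auto
  show "\<forall>x\<in>S. \<exists>c. (\<forall>g\<in>G. c g \<in> Fs) \<and> x = (\<Sum>g\<in>G. c g * g \<alpha>)"
  proof
    fix x assume "x \<in> S"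
    then obtain q where q: "poly_over Fs q" "x = (\<Sum>j = 0..<n. coeff q j * \<alpha> ^ j)"
      using representation[OF \<alpha>] n by metis
    \<comment> \<open>Column \<open>i\<close> of \<open>C\<close> holds the coordinates of
      \<open>- e i \<alpha>\<close> in the powers of \<open>\<alpha>\<close>, so the coordinates of
      \<open>x\<close> also enter with a minus sign.\<close>
    define b where "b = vec n (\<lambda>j. - coeff q j)"
    obtain d where d: "d \<in> carrier_vec n" "\<And>i. i < n \<Longrightarrow> d $ i \<in> Fs" "C *\<^sub>v d = b"
      by (rule Fs.linear_system_solvable[of C n b, OF C _ \<open>det C \<noteq> 0\<close>])
        (use p(1) q(1) in \<open>auto simp: C_def b_def poly_over_def Fs.uminus_mem\<close>)
    define c where "c g = d $ (the_inv_into {0..<n} e g)" for g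
    have ce: "c (e j) = d $ j" if "j < n" for j
      using e that by (simp add: c_def the_inv_into_f_f bij_betw_def)
    have "(\<Sum>g\<in>G. c g * g \<alpha>) = (\<Sum>i = 0..<n. d $ i * e i \<alpha>)"
      by (simp add: reindex ce)
    also have "\<dots> = - (\<Sum>i = 0..<n. d $ i * poly (p i) \<alpha>)"
      by (simp flip: p(2) add: sum_negf)
    also have "(\<Sum>i = 0..<n. d $ i * poly (p i) \<alpha>) =
        (\<Sum>i = 0..<n. \<Sum>j = 0..<n. coeff (p i) j * d $ i * \<alpha> ^ j)"
      by (simp add: p_sum sum_distrib_left mult_ac)
    also have "\<dots> = (\<Sum>j = 0..<n. (C *\<^sub>v d) $ j * \<alpha> ^ j)"
      using d(1) by (subst sum.swap) (simp add: C_def scalar_prod_def sum_distrib_right)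
    also have "\<dots> = - x"
      unfolding d(3) q(2) by (simp add: b_def sum_negf)
    finally have "x = (\<Sum>g\<in>G. c g * g \<alpha>)" by simp
    moreover have "\<forall>g\<in>G. c g \<in> Fs"
    proof
      fix g assume "g \<in> G"
      then obtain j where "j < n" "g = e j" using e by (force simp: bij_betw_def)
      then show "c g \<in> Fs" using ce d(2) by simp
    qed
    ultimately show "\<exists>c. (\<forall>g\<in>G. c g \<in> Fs) \<and> x = (\<Sum>g\<in>G. c g * g \<alpha>)" by blast
  qed
qed

end

theorem theorem5p1:
  fixes Fs :: "'K::field set" and f :: "'K poly" and n :: nat
    and k :: nat and m :: "nat \<Rightarrow> nat"
    and \<rho> :: "nat \<Rightarrow> ('K \<Rightarrow> 'K) \<Rightarrow> complex mat"
    and E :: "nat \<Rightarrow> ('K \<Rightarrow> 'K, complex) mpoly"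
    and H :: "nat \<Rightarrow> (nat, complex) mpoly"
    and \<phi> :: "complex \<Rightarrow> 'K"
  defines "S \<equiv> splitting_field Fs f"
  defines "G \<equiv> field_auts Fs S"
  defines "a \<equiv> (\<lambda>j. coeff f (n - j))"
  assumes closure: "is_alg_closure_of Fs"
    and f_over: "poly_over Fs f" and f_monic: "lead_coeff f = 1" and f_deg: "degree f = n"
    and f_irr: "irreducible_over Fs f" and f_sep: "rsquarefree f"
    and f_normal_ext: "\<And>\<alpha>. poly f \<alpha> = 0 \<Longrightarrow> field_adjoin Fs {\<alpha>} = S"
    and irreps: "complete_irreps G k m \<rho>"
    and E_int: "\<And>i. i < k \<Longrightarrow> mcoeffs_in (E i) alg_ints"
    and E_mult: "\<And>i. i < k \<Longrightarrow> \<exists>Q. mcoeffs_in Q alg_ints \<and>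
                     E i = Q * group_det_factor G (m i) (\<rho> i)"
    and E_sym: "\<And>i. i < k \<Longrightarrow> msymmetric G (E i)"
    and H_int: "\<And>i. i < k \<Longrightarrow> mcoeffs_in (H i) alg_ints"
    and H_vars: "\<And>i. i < k \<Longrightarrow> mvars_in (H i) {1..n}"
    and H_red: "\<And>i. i < k \<Longrightarrow> E i = msubst (H i) (elem_sym G)"
    and \<phi>_one: "\<phi> 1 = 1"
    and \<phi>_add: "\<And>x y. x \<in> alg_ints \<Longrightarrow> y \<in> alg_ints \<Longrightarrow> \<phi> (x + y) = \<phi> x + \<phi> y"
    and \<phi>_mult: "\<And>x y. x \<in> alg_ints \<Longrightarrow> y \<in> alg_ints \<Longrightarrow> \<phi> (x * y) = \<phi> x * \<phi> y"
    and H_nonzero: "\<And>i. i < k \<Longrightarrow> meval_map \<phi> (H i) a \<noteq> 0"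
  shows "\<forall>\<alpha>. poly f \<alpha> = 0 \<longrightarrow>
           (\<forall>c. (\<forall>g\<in>G. c g \<in> Fs) \<and> (\<Sum>g\<in>G. c g * g \<alpha>) = 0 \<longrightarrow> (\<forall>g\<in>G. c g = 0)) \<and>
           (\<forall>x\<in>S. \<exists>c. (\<forall>g\<in>G. c g \<in> Fs) \<and> x = (\<Sum>g\<in>G. c g * g \<alpha>))"
proof (intro allI impI)
  fix \<alpha> assume \<alpha>: "poly f \<alpha> = 0"
  interpret normal_simple_extension Fs f S
    by unfold_locales (use closure f_monic f_irr f_sep f_normal_ext in auto)
  interpret subring_hom alg_ints \<phi>
    by unfold_locales
      (auto simp: alg_ints_def algebraic_int_add algebraic_int_mult \<phi>_one
        intro: \<phi>_add[unfolded alg_ints_def mem_Collect_eq] \<phi>_mult[unfolded alg_ints_def mem_Collect_eq])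
  have card: "card G = n" and fin: "finite G"
    using card_G finite_G f_deg by (simp_all add: G_def)
  obtain e where e: "bij_betw e {0..<n} G"
    using ex_bij_betw_nat_finite[OF fin] card by auto
  define x where "x = (\<lambda>g::'K \<Rightarrow> 'K. - g \<alpha>)"
  have f_prod: "(\<Prod>g\<in>G. [:x g, 1:]) = f"
    using f_eq_prod[OF \<alpha>] by (simp add: G_def x_def)
  have sym: "eval x (elem_sym G j) = a j" if "j \<in> {1..n}" for j
    using coeff_prod_linear_factors[OF fin, of j x, unfolded card f_prod] that
    by (simp add: eval_elem_sym a_def)
  have E_eval: "eval x (E i) \<noteq> 0" if "i < k" for i
  proof -
    have "eval x (E i) = eval (\<lambda>j. eval x (elem_sym G j)) (H i)"
      unfolding H_red[OF that] by (rule eval_msubst[OF H_int[OF that] Rpoly_elem_sym])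
    also have "\<dots> = eval a (H i)"
      \<comment> \<open>The value \<open>a j\<close> of \<open>elem_sym G j\<close> is established
        for \<open>j\<close> from 1 to \<open>n\<close>; these are the only variables of
        \<open>H i\<close>.\<close>
      by (rule meval_map_cong[OF H_vars[OF that] sym])
    finally show ?thesis using H_nonzero[OF that] by simp
  qed
  obtain Q where Q: "\<And>i. i < k \<Longrightarrow> mcoeffs_in (Q i) alg_ints"
      "\<And>i. i < k \<Longrightarrow> E i = Q i * group_det_factor G (m i) (\<rho> i)"
    using E_mult by metis
  let ?M = "mat n n (\<lambda>(r,c). mvar (inv_into UNIV (e r) \<circ> e c)) :: ('K \<Rightarrow> 'K, complex) mpoly mat"
  obtain js where js: "set js \<subseteq> {..<k}" "det ?M = (\<Prod>i\<leftarrow>js. group_det_factor G (m i) (\<rho> i))"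
    using group_det_eq_prod_irreps[OF irreps e] id_in_G comp_in_G aut_bij inv_in_G
    unfolding G_def by blast
  \<comment> \<open>The list \<open>js\<close> may repeat an index, one entry for each composition
    factor, so the cofactors \<open>Q i\<close> are multiplied with the same repetitions.\<close>
  have "det ?M * (\<Prod>i\<leftarrow>js. Q i) = (\<Prod>i\<leftarrow>js. E i)"
    unfolding js(2) using js(1) by (induction js) (auto simp: Q(2) mult_ac)
  moreover have "Rpoly (det ?M)"
    by (rule Rpoly_det[of _ n]) (auto simp: Rpoly_mvar)
  moreover have "Rpoly (\<Prod>i\<leftarrow>js. Q i)"
    using js(1) Q(1) by (intro Rpoly_prod_list) auto
  ultimately have "eval x (det ?M) * eval x (\<Prod>i\<leftarrow>js. Q i) = eval x (\<Prod>i\<leftarrow>js. E i)"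
    by (metis eval_mult)
  also have "\<dots> = (\<Prod>i\<leftarrow>js. eval x (E i))"
    using js(1) E_int by (intro eval_prod_list) auto
  also have "\<dots> \<noteq> 0"
    using js(1) E_eval by (auto simp: prod_list_zero_iff)
  finally have "eval x (det ?M) \<noteq> 0" by auto
  also have "eval x (det ?M) = det (map_mat (eval x) ?M)"
    by (rule eval_det[of _ n]) (auto simp: Rpoly_mvar)
  also have "map_mat (eval x) ?M = mat n n (\<lambda>(r,c). - (inv_into UNIV (e r) \<circ> e c) \<alpha>)"
    by (intro eq_matI) (auto simp: eval_mvar x_def)
  finally have "det (mat n n (\<lambda>(r,c). - (inv_into UNIV (e r) \<circ> e c) \<alpha>)) \<noteq> 0" .
  from normal_basis_if_group_det_nonzero[OF \<alpha> e[unfolded G_def] f_deg this]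
  show "(\<forall>c. (\<forall>g\<in>G. c g \<in> Fs) \<and> (\<Sum>g\<in>G. c g * g \<alpha>) = 0 \<longrightarrow> (\<forall>g\<in>G. c g = 0)) \<and>
      (\<forall>x\<in>S. \<exists>c. (\<forall>g\<in>G. c g \<in> Fs) \<and> x = (\<Sum>g\<in>G. c g * g \<alpha>))"
    unfolding G_def by blast
qed

end
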